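(* Let $K$ be an algebraically closed field of characteristic zero, and let $f:K[x,y]\to K[x,y]$ be a $K$-algebra endomorphism such that $\mathrm{Jac}(f(x),f(y))\in K^*$. Put $P=f(x)$, $Q=f(y)$, and let $K[P,Q][x+y]$ be the $K$-subalgebra of $K[x,y]$ generated by $P,Q,x+y$. If $K[P,Q][x+y]$ is a regular ring, then $f$ is invertible.
   Context: A commutative ring is regular if it is Noetherian and its localization at every prime ideal is a regular local ring. *)

theory Defs
  imports "HOL-Algebra.Ideal" "HOL-Algebra.Ring_Divisibility"
          "HOL-Computational_Algebra.Polynomial" "HOL-Computational_Algebra.Fraction_Field" "HOL-Library.Extended_Nat"
begin

text \<open>An element h of K[x,y] is represented as a polynomial in y whose coefficients
are polynomials in x (type 'a poly poly).\<close>

definition varX :: "'a::idom poly poly" where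
  "varX = [:[:0, 1:]:]"

definition varY :: "'a::idom poly poly" where
  "varY = [:0, 1:]"

definition constK :: "'a::idom \<Rightarrow> 'a poly poly" where
  "constK c = [:[:c:]:]"

definition dX :: "'a::idom poly poly \<Rightarrow> 'a poly poly" where
  "dX h = map_poly pderiv h"

definition dY :: "'a::idom poly poly \<Rightarrow> 'a poly poly" where
  "dY h = pderiv h"

definition jac :: "'a::idom poly poly \<Rightarrow> 'a poly poly \<Rightarrow> 'a poly poly" where
  "jac P Q = dX P * dY Q - dY P * dX Q"

definition is_K_alg_endo :: "('a::idom poly poly \<Rightarrow> 'a poly poly) \<Rightarrow> bool" where
  "is_K_alg_endo f \<longleftrightarrow>
     (\<forall>a b. f (a + b) = f a + f b) \<and> (\<forall>a b. f (a * b) = f a * f b) \<and>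
     f 1 = 1 \<and> (\<forall>c. f (constK c) = constK c)"

definition alg_closed :: "'a::field itself \<Rightarrow> bool" where
  "alg_closed _ \<longleftrightarrow> (\<forall>p :: 'a poly. degree p \<ge> 1 \<longrightarrow> (\<exists>z. poly p z = 0))"

inductive_set K_subalg_gen :: "'a::idom poly poly set \<Rightarrow> 'a poly poly set"
  for G where
  const: "constK c \<in> K_subalg_gen G"
| gen: "g \<in> G \<Longrightarrow> g \<in> K_subalg_gen G"
| add: "a \<in> K_subalg_gen G \<Longrightarrow> b \<in> K_subalg_gen G \<Longrightarrow> a + b \<in> K_subalg_gen G"
| mult: "a \<in> K_subalg_gen G \<Longrightarrow> b \<in> K_subalg_gen G \<Longrightarrow> a * b \<in> K_subalg_gen G"

definition ring_of_set :: "'b::comm_ring_1 set \<Rightarrow> 'b ring" where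
  "ring_of_set S = \<lparr>carrier = S, monoid.mult = (*), one = 1, zero = 0, add = (+)\<rparr>"

definition krull_dim :: "('b, 'c) ring_scheme \<Rightarrow> enat" where
  "krull_dim R = Sup {enat n | n. \<exists>c :: nat \<Rightarrow> 'b set.
      (\<forall>i\<le>n. primeideal (c i) R) \<and> (\<forall>i<n. c i \<subset> c (Suc i))}"

definition min_num_gens :: "('b, 'c) ring_scheme \<Rightarrow> 'b set \<Rightarrow> nat" where
  "min_num_gens R I = (LEAST n. \<exists>G. finite G \<and> card G = n \<and> G \<subseteq> carrier R \<and> genideal R G = I)"

definition local_ring :: "('b, 'c) ring_scheme \<Rightarrow> bool" where
  "local_ring R \<longleftrightarrow> cring R \<and> (\<exists>!m. maximalideal m R)"

definition regular_local_ring :: "('b, 'c) ring_scheme \<Rightarrow> bool" where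
  "regular_local_ring R \<longleftrightarrow> noetherian_ring R \<and> local_ring R \<and>
     (\<exists>m. maximalideal m R \<and> krull_dim R = enat (min_num_gens R m))"

definition localization_at :: "'b::idom set \<Rightarrow> 'b set \<Rightarrow> 'b fract ring" where
  "localization_at A p = ring_of_set {Fract a s | a s. a \<in> A \<and> s \<in> A \<and> s \<notin> p}"

definition regular_ring :: "'b::idom set \<Rightarrow> bool" where
  "regular_ring A \<longleftrightarrow> noetherian_ring (ring_of_set A) \<and>
     (\<forall>p. primeideal p (ring_of_set A) \<longrightarrow> regular_local_ring (localization_at A p))"

end

theory Submission
  imports Defs "Berlekamp_Zassenhaus.Unique_Factorization_Poly"
begin

text \<open>Let \<open>w = x + y\<close> and let \<open>F(u,v,t)\<close> generate the principal prime ideal of relations between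
  \<open>P\<close>, \<open>Q\<close> and \<open>w\<close>.  Differentiating \<open>F(P,Q,w) = 0\<close> and inverting the Jacobian matrix shows that
  \<open>F\<^sub>u\<close> and \<open>F\<^sub>v\<close> vanish wherever \<open>F\<^sub>t(P,Q,w)\<close> vanishes on the plane; such a point would map to a
  singular point of the surface \<open>F = 0\<close>, which regularity of \<open>K[P,Q,w]\<close> excludes.  Hence
  \<open>F\<^sub>t(P,Q,w)\<close> is a nonzero constant, \<open>F\<close> is linear in \<open>t\<close> with constant leading coefficient, and
  \<open>w\<close> lies in \<open>A = K[P,Q]\<close>.

  After a linear change of coordinates \<open>x \<in> A\<close>.  Then \<open>A\<close> is stable under \<open>\<partial>/\<partial>y\<close>, so it contains
  \<open>h(x) y\<close> for some \<open>h \<noteq> 0\<close>, which we choose of least degree.  If \<open>h(\<lambda>) = 0\<close>, the ideals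
  \<open>0 \<subset> (x - \<lambda>) A \<subset> (x - \<lambda>) K[x,y] \<inter> A\<close> together with a point would form a chain of four primes in
  the two-dimensional ring \<open>A\<close>.  So \<open>h\<close> is constant and \<open>A = K[x,y]\<close>.\<close>

subsection \<open>Evaluation homomorphisms and derivations\<close>

lemma comm_ring_hom_eval:
  assumes "comm_ring_hom h"
  shows "comm_ring_hom (\<lambda>p. poly (map_poly h p) x)"
proof -
  interpret h: comm_ring_hom h by fact
  interpret m: map_poly_comm_ring_hom h ..
  show ?thesis
    by unfold_locales (simp_all add: m.hom_add m.hom_mult)
qed

lemma comm_ring_hom_constK: "comm_ring_hom constK"
  by unfold_locales (simp_all add: constK_def)

text \<open>The evaluations follow the nesting of the polynomial type: each serves as the
  coefficient map of the next, and the innermost variable goes to \<open>a\<close>. Thus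
  \<open>comm_ring_hom_eval\<close> covers all three, and a relation in three variables can later be
  peeled one variable at a time.\<close>

definition eval1 :: "'a::idom poly poly \<Rightarrow> 'a poly \<Rightarrow> 'a poly poly" where
  "eval1 a p = poly (map_poly constK p) a"

definition eval2 :: "'a::idom poly poly \<Rightarrow> 'a poly poly \<Rightarrow> 'a poly poly \<Rightarrow> 'a poly poly" where
  "eval2 a b h = poly (map_poly (eval1 a) h) b"

definition eval3 :: "'a::idom poly poly \<Rightarrow> 'a poly poly \<Rightarrow> 'a poly poly \<Rightarrow> 'a poly poly poly \<Rightarrow> 'a poly poly" where
  "eval3 a b c H = poly (map_poly (eval2 a b) H) c"

definition eval_at :: "'a::idom \<Rightarrow> 'a \<Rightarrow> 'a poly poly \<Rightarrow> 'a" where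
  "eval_at x y h = poly (poly h [:y:]) x"

lemma comm_ring_hom_eval1: "comm_ring_hom (eval1 a)"
  unfolding eval1_def[abs_def] by (intro comm_ring_hom_eval comm_ring_hom_constK)

lemma comm_ring_hom_eval2: "comm_ring_hom (eval2 a b)"
  unfolding eval2_def[abs_def] by (intro comm_ring_hom_eval comm_ring_hom_eval1)

lemma comm_ring_hom_eval3: "comm_ring_hom (eval3 a b c)"
  unfolding eval3_def[abs_def] by (intro comm_ring_hom_eval comm_ring_hom_eval2)

lemma comm_ring_hom_eval_at: "comm_ring_hom (eval_at x y)"
  by unfold_locales (simp_all add: eval_at_def)

lemma bipoly_induct [case_names constK varX varY add mult]:
  fixes h :: "'a::idom poly poly"
  assumes "\<And>c. R (constK c)" "R varX" "R varY"
    and "\<And>a b. R a \<Longrightarrow> R b \<Longrightarrow> R (a + b)" "\<And>a b. R a \<Longrightarrow> R b \<Longrightarrow> R (a * b)"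
  shows "R h"
proof (induction h)
  case 0
  then show ?case using assms(1)[of 0] by (simp add: constK_def)
next
  case (pCons p h)
  have "R [:p:]"
  proof (induction p)
    case 0
    then show ?case using assms(1)[of 0] by (simp add: constK_def)
  next
    case (pCons c p)
    have "[:pCons c p:] = constK c + varX * [:p:]"
      by (simp add: constK_def varX_def)
    then show ?case using assms pCons by metis
  qed
  moreover have "pCons p h = [:p:] + varY * h"
    by (simp add: varY_def)
  ultimately show ?case using assms pCons by metis
qed

lemma endo_comm_ring_hom:
  assumes "is_K_alg_endo f"
  shows "comm_ring_hom f"
proof -
  have "f (0 + 0) = f 0 + f 0"
    using assms unfolding is_K_alg_endo_def by blast
  then have "f 0 = 0" by (metis add_cancel_right_left add_0)
  then show ?thesis
    using assms unfolding is_K_alg_endo_def by unfold_locales simp_all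
qed

lemma endo_constK: "is_K_alg_endo f \<Longrightarrow> f (constK c) = constK c"
  by (simp add: is_K_alg_endo_def)

lemma is_K_alg_endoI:
  assumes "comm_ring_hom f" "\<And>c. f (constK c) = constK c"
  shows "is_K_alg_endo f"
proof -
  interpret comm_ring_hom f by fact
  show ?thesis
    by (simp add: is_K_alg_endo_def assms(2) hom_add hom_mult)
qed

lemma endo_eqI:
  assumes f: "is_K_alg_endo f" and g: "is_K_alg_endo g"
    and "f varX = g varX" "f varY = g varY"
  shows "f = g"
proof
  fix h
  show "f h = g h"
    using assms by (induction h rule: bipoly_induct) (simp_all add: is_K_alg_endo_def)
qed

lemma endo_comp: "is_K_alg_endo f \<Longrightarrow> is_K_alg_endo g \<Longrightarrow> is_K_alg_endo (f \<circ> g)"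
  by (simp add: is_K_alg_endo_def)

lemma endo_id: "is_K_alg_endo id"
  by (simp add: is_K_alg_endo_def)

lemma eval1_pCons: "eval1 (a :: 'a::idom poly poly) (pCons c p) = constK c + a * eval1 a p"
proof -
  interpret comm_ring_hom "constK :: 'a \<Rightarrow> _" by (rule comm_ring_hom_constK)
  show ?thesis by (simp add: eval1_def Polynomial.map_poly_pCons)
qed

lemma eval1_constK: "eval1 a [:c:] = constK c"
  by (simp add: eval1_pCons) (simp add: eval1_def)

lemma endo_eval2: "is_K_alg_endo (eval2 a b)"
proof (rule is_K_alg_endoI[OF comm_ring_hom_eval2])
  interpret e: comm_ring_hom "eval1 a" by (rule comm_ring_hom_eval1)
  show "eval2 a b (constK c) = constK c" for c
    by (simp add: eval2_def constK_def[of c] Polynomial.map_poly_pCons eval1_constK)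
qed

lemma eval2_varX [simp]: "eval2 a (b :: 'a::idom poly poly) varX = a"
proof -
  interpret c: comm_ring_hom "constK :: 'a \<Rightarrow> _" by (rule comm_ring_hom_constK)
  interpret e: comm_ring_hom "eval1 a" by (rule comm_ring_hom_eval1)
  show ?thesis
    by (simp add: eval2_def varX_def Polynomial.map_poly_pCons eval1_pCons)
qed

lemma eval2_varY [simp]: "eval2 a b varY = b"
proof -
  interpret e: comm_ring_hom "eval1 a" by (rule comm_ring_hom_eval1)
  show ?thesis
    by (simp add: eval2_def varY_def Polynomial.map_poly_pCons)
qed

lemma endo_eq_eval2:
  assumes "is_K_alg_endo f"
  shows "f = eval2 (f varX) (f varY)"
  by (rule endo_eqI[OF assms endo_eval2]) simp_all

section \<open>Derivations and the chain rule\<close>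

definition derivation :: "('r::comm_ring_1 \<Rightarrow> 'r) \<Rightarrow> bool" where
  "derivation d \<longleftrightarrow> (\<forall>a b. d (a + b) = d a + d b) \<and> (\<forall>a b. d (a * b) = d a * b + a * d b)"

lemma derivation_add: "derivation d \<Longrightarrow> d (a + b) = d a + d b"
  by (simp add: derivation_def)

lemma derivation_mult: "derivation d \<Longrightarrow> d (a * b) = d a * b + a * d b"
  by (simp add: derivation_def)

lemma derivation_0: "derivation d \<Longrightarrow> d 0 = 0"
proof -
  assume "derivation d"
  then have "d (0 + 0) = d 0 + d 0" unfolding derivation_def by blast
  then show ?thesis by simp
qed

lemma derivation_1: "derivation d \<Longrightarrow> d 1 = 0"
proof -
  assume "derivation d"
  then have "d (1 * 1) = d 1 * 1 + 1 * d 1" unfolding derivation_def by blast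
  then show ?thesis by simp
qed

lemma derivation_diff: "derivation d \<Longrightarrow> d (a - b) = d a - d b"
proof -
  assume "derivation d"
  then have "d ((a - b) + b) = d (a - b) + d b" unfolding derivation_def by blast
  then show ?thesis by simp
qed

lemma derivation_pderiv: "derivation (pderiv :: 'r::idom poly \<Rightarrow> _)"
  by (simp add: derivation_def pderiv_add pderiv_mult algebra_simps)

lemma derivation_map_poly:
  assumes d: "derivation d"
  shows "derivation (map_poly d)"
proof -
  note d0 = derivation_0[OF d]
  have add: "map_poly d (a + b) = map_poly d a + map_poly d b" for a b
    using d d0 by (intro poly_eqI) (simp add: coeff_map_poly derivation_def)
  have sm: "map_poly d (smult r b) = smult (d r) b + smult r (map_poly d b)" for r b
    using d d0 by (intro poly_eqI) (simp add: coeff_map_poly derivation_def)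
  have "map_poly d (a * b) = map_poly d a * b + a * map_poly d b" for a b
    by (induction a) (simp_all add: d0 Polynomial.map_poly_pCons add sm algebra_simps)
  with add show ?thesis by (simp add: derivation_def)
qed

lemma derivation_dX: "derivation dX"
  unfolding dX_def[abs_def] by (intro derivation_map_poly derivation_pderiv)

lemma derivation_dY: "derivation dY"
  unfolding dY_def[abs_def] by (rule derivation_pderiv)

lemma dX_simps [simp]: "dX (constK c) = 0" "dX varX = 1" "dX varY = 0" "dX [:p:] = [:pderiv p:]"
  by (simp_all add: dX_def constK_def varX_def varY_def Polynomial.map_poly_pCons pderiv_pCons
      derivation_1[OF derivation_map_poly[OF derivation_pderiv]])

lemma dY_simps [simp]: "dY (constK c) = 0" "dY varX = 0" "dY varY = 1" "dY [:p:] = 0"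
  by (simp_all add: dY_def constK_def varX_def varY_def pderiv_pCons)

text \<open>Both sides are additive in \<open>h\<close> and satisfy the Leibniz rule along
  \<open>f\<close>, so agreement on constants and on the two variables suffices.\<close>

lemma chain_rule2:
  assumes f: "is_K_alg_endo f" and D: "derivation D" and DK: "\<And>c. D (constK c) = 0"
  shows "D (f h) = f (dX h) * D (f varX) + f (dY h) * D (f varY)"
proof -
  interpret f: comm_ring_hom f by (rule endo_comm_ring_hom[OF f])
  note rules = D[THEN derivation_add] D[THEN derivation_mult]
    derivation_dX[THEN derivation_add] derivation_dX[THEN derivation_mult]
    derivation_dY[THEN derivation_add] derivation_dY[THEN derivation_mult]
  show ?thesis
    by (induction h rule: bipoly_induct)
       (simp_all add: DK endo_constK[OF f] f.hom_add f.hom_mult rules algebra_simps)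
qed

text \<open>Reading \<open>H\<close> as a polynomial in u, v, t, its three partial derivatives are
  \<open>map_poly dX H\<close>, \<open>map_poly dY H\<close> and \<open>pderiv H\<close>. The
  derivation \<open>D\<close> stays general so that both \<open>dX\<close> and \<open>dY\<close> can
  be inserted.\<close>

lemma chain_rule3:
  fixes w :: "'a::idom poly poly"
  assumes f: "is_K_alg_endo f" and D: "derivation D" and DK: "\<And>c. D (constK c) = 0"
  defines "\<Psi> \<equiv> \<lambda>H. poly (map_poly f H) w"
  shows "D (\<Psi> H) = \<Psi> (map_poly dX H) * D (f varX) + \<Psi> (map_poly dY H) * D (f varY) + \<Psi> (pderiv H) * D w"
proof -
  interpret f: comm_ring_hom f by (rule endo_comm_ring_hom[OF f])
  interpret \<Psi>: comm_ring_hom \<Psi>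
    unfolding \<Psi>_def by (intro comm_ring_hom_eval endo_comm_ring_hom f)
  note d0 = derivation_0[OF derivation_dX] derivation_0[OF derivation_dY] derivation_0[OF D]
  have pC: "\<Psi> (pCons a H) = f a + w * \<Psi> H" for a H
    by (simp add: \<Psi>_def Polynomial.map_poly_pCons)
  show ?thesis
  proof (induction H)
    case 0
    then show ?case by (simp add: d0)
  next
    case (pCons a H)
    then show ?case
      using D chain_rule2[OF f D DK, of a]
      by (simp add: d0 Polynomial.map_poly_pCons pderiv_pCons pC \<Psi>.hom_add derivation_def algebra_simps)
  qed
qed

text \<open>In characteristic zero \<open>pderiv\<close> lowers a positive degree by exactly one, so
  repeated differentiation passes through every smaller degree. Degree 0 serves injectivity; degree
  1 serves to isolate a multiple of \<open>varY\<close>.\<close>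

lemma pderiv_closed_degree:
  fixes h :: "'r::{idom,ring_char_0} poly"
  assumes "\<And>h. h \<in> S \<Longrightarrow> pderiv h \<in> S" "h \<in> S" "h \<noteq> 0" "k \<le> degree h"
  shows "\<exists>h'\<in>S. h' \<noteq> 0 \<and> degree h' = k"
  using assms(2-)
proof (induction "degree h" arbitrary: h)
  case 0
  then show ?case by auto
next
  case (Suc n)
  show ?case
  proof (cases "k = Suc n")
    case True
    then show ?thesis using Suc by metis
  next
    case False
    have "degree (pderiv h) = n" "pderiv h \<noteq> 0"
      using Suc.hyps(2) by (auto simp: degree_pderiv pderiv_eq_0_iff)
    then show ?thesis
      using Suc False assms(1) by (metis le_SucE)
  qed
qed

subsection \<open>Algebraic dependence and chains of primes\<close>

text \<open>Gaussian elimination by induction on the equations: an equation with a nonzero entry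
  removes one unknown, so fewer equations than unknowns remain.\<close>

lemma homogeneous_system_nontrivial:
  fixes M :: "'s \<Rightarrow> 't \<Rightarrow> 'a::field"
  assumes "finite T" "finite S" "card T < card S"
  shows "\<exists>c. (\<exists>s\<in>S. c s \<noteq> 0) \<and> (\<forall>t\<in>T. (\<Sum>s\<in>S. c s * M s t) = 0)"
  using assms
proof (induction T arbitrary: S M rule: finite_induct)
  case empty
  then have "S \<noteq> {}" by auto
  then show ?case by (intro exI[of _ "\<lambda>_. 1"]) auto
next
  case (insert t T)
  show ?case
  proof (cases "\<forall>s\<in>S. M s t = 0")
    case True
    have "card T < card S" using insert by auto
    from insert.IH[OF \<open>finite S\<close> this, of M] True show ?thesis by auto
  next
    case False
    then obtain s0 where s0: "s0 \<in> S" "M s0 t \<noteq> 0" by auto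
    define S' where "S' = S - {s0}"
    have S: "S = insert s0 S'" "s0 \<notin> S'" "finite S'" "card T < card S'"
      using s0 insert by (auto simp: S'_def)
    obtain c where c: "\<exists>s\<in>S'. c s \<noteq> 0"
      "\<And>t'. t' \<in> T \<Longrightarrow> (\<Sum>s\<in>S'. c s * (M s t' - M s t / M s0 t * M s0 t')) = 0"
      using insert.IH[OF S(3,4), of "\<lambda>s t'. M s t' - M s t / M s0 t * M s0 t'"] by auto
    \<comment> \<open>The value at the pivot \<open>s0\<close> is the one that solves equation
      \<open>t\<close>; with it, the other equations become the reduced ones.\<close>
    define c' where "c' s = (if s = s0 then - (\<Sum>s\<in>S'. c s * M s t) / M s0 t else c s)" for s
    have sum: "(\<Sum>s\<in>S. c' s * M s t') = (\<Sum>s\<in>S'. c s * M s t') - (\<Sum>s\<in>S'. c s * M s t) / M s0 t * M s0 t'" for t'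
    proof -
      have "(\<Sum>s\<in>S'. c' s * M s t') = (\<Sum>s\<in>S'. c s * M s t')"
        using S(2) by (intro sum.cong) (auto simp: c'_def)
      then show ?thesis using S by (simp add: c'_def)
    qed
    have "(\<Sum>s\<in>S. c' s * M s t') = 0" if "t' \<in> insert t T" for t'
    proof (cases "t' = t")
      case True
      then show ?thesis using s0 by (simp add: sum)
    next
      case False
      then have "0 = (\<Sum>s\<in>S'. c s * (M s t' - M s t / M s0 t * M s0 t'))"
        using that c(2) by simp
      also have "\<dots> = (\<Sum>s\<in>S. c' s * M s t')"
        by (simp add: sum right_diff_distrib sum_subtractf sum_distrib_right sum_divide_distrib mult.assoc)
      finally show ?thesis by simp
    qed
    moreover have "\<exists>s\<in>S. c' s \<noteq> 0" using c(1) S by (auto simp: c'_def)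
    ultimately show ?thesis by blast
  qed
qed

definition bidegree_le :: "nat \<Rightarrow> 'a::idom poly poly \<Rightarrow> bool" where
  "bidegree_le n h \<longleftrightarrow> degree h \<le> n \<and> (\<forall>i. degree (coeff h i) \<le> n)"

lemma bidegree_le_ex: "\<exists>n. bidegree_le n h"
proof -
  let ?n = "degree h + (\<Sum>i\<le>degree h. degree (coeff h i))"
  have "degree (coeff h i) \<le> ?n" for i
  proof (cases "i \<le> degree h")
    case True
    then have "degree (coeff h i) \<le> (\<Sum>i\<le>degree h. degree (coeff h i))"
      by (intro member_le_sum) auto
    then show ?thesis by simp
  qed (simp add: coeff_eq_0)
  then have "bidegree_le ?n h" by (simp add: bidegree_le_def)
  then show ?thesis by blast
qed

lemma bidegree_le_mono: "bidegree_le m h \<Longrightarrow> m \<le> n \<Longrightarrow> bidegree_le n h"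
  by (auto simp: bidegree_le_def intro: order_trans)

lemma bidegree_le_mult:
  assumes "bidegree_le m g" "bidegree_le n h"
  shows "bidegree_le (m + n) (g * h)"
  unfolding bidegree_le_def
proof (intro conjI allI)
  show "degree (g * h) \<le> m + n"
    using assms degree_mult_le[of g h] by (auto simp: bidegree_le_def)
  fix i
  have "degree (coeff g j * coeff h (i - j)) \<le> m + n" for j
    using assms degree_mult_le[of "coeff g j" "coeff h (i - j)"]
    by (meson add_mono bidegree_le_def order_trans)
  then show "degree (coeff (g * h) i) \<le> m + n"
    unfolding coeff_mult by (intro degree_sum_le) auto
qed

lemma bidegree_le_power:
  assumes "bidegree_le d h"
  shows "bidegree_le (d * k) (h ^ k)"
proof (induction k)
  case 0
  then show ?case by (simp add: bidegree_le_def flip: one_pCons)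
next
  case (Suc k)
  then show ?case using bidegree_le_mult[OF assms Suc] by simp
qed

lemma constK_mult: "constK c * h = smult [:c:] h"
  by (simp add: constK_def)

lemma eval3_monom: "eval3 a b c (monom (monom (monom r i) j) k) = constK r * a ^ i * b ^ j * c ^ k"
proof -
  interpret c0: comm_ring_hom "constK :: 'a \<Rightarrow> _" by (rule comm_ring_hom_constK)
  interpret c1: comm_ring_hom "eval1 a" by (rule comm_ring_hom_eval1)
  interpret c2: comm_ring_hom "eval2 a b" by (rule comm_ring_hom_eval2)
  show ?thesis
    by (simp add: eval3_def eval2_def eval1_def map_poly_monom poly_monom)
qed

text \<open>A dimension count: the products of powers of \<open>a\<close>, \<open>b\<close>,
  \<open>c\<close> with exponents below N number N^3, but they lie in a space of polynomials whose
  dimension grows only like N^2. For large N they are linearly dependent.\<close>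

lemma algebraic_dependence:
  fixes a b c :: "'a::field poly poly"
  shows "\<exists>H. H \<noteq> 0 \<and> eval3 a b c H = 0"
proof -
  obtain n1 n2 n3 where n: "bidegree_le n1 a" "bidegree_le n2 b" "bidegree_le n3 c"
    using bidegree_le_ex by metis
  define d where "d = n1 + n2 + n3"
  have d: "bidegree_le d a" "bidegree_le d b" "bidegree_le d c"
    using n by (auto simp: d_def intro: bidegree_le_mono)
  \<comment> \<open>The box \<open>T\<close> has at most (3 (d+1) N)^2 = 9 (d+1)^2 N^2 elements;
    this \<open>N\<close> exceeds 9 (d+1)^2 by one, which makes N^3 larger.\<close>
  define N where "N = Suc (9 * Suc d * Suc d)"
  define S where "S = {..<N} \<times> {..<N} \<times> {..<N}"
  define T where "T = {..3*d*N} \<times> {..3*d*N}"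
  define m where "m = (\<lambda>(i,j,k). a ^ i * b ^ j * c ^ k)"
  have fin: "finite S" "finite T" by (simp_all add: S_def T_def)
  have "Suc (3*d*N) \<le> 3 * Suc d * N"
    by (simp add: algebra_simps) (simp add: N_def)
  have "card T = Suc (3*d*N) * Suc (3*d*N)" by (simp add: T_def)
  also have "\<dots> \<le> (3 * Suc d * N) * (3 * Suc d * N)"
    using \<open>Suc (3*d*N) \<le> 3 * Suc d * N\<close> by (intro mult_le_mono)
  also have "\<dots> = (9 * Suc d * Suc d) * (N * N)" by (simp add: algebra_simps)
  also have "\<dots> < N * (N * N)" by (intro mult_strict_right_mono) (simp_all add: N_def)
  also have "\<dots> = card S" by (simp add: S_def)
  finally have "card T < card S" .
  from homogeneous_system_nontrivial[OF fin(2,1) this, of "\<lambda>s (i,j). coeff (coeff (m s) i) j"]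
  obtain r where r: "\<exists>s\<in>S. r s \<noteq> 0"
    and "\<forall>t\<in>T. (\<Sum>s\<in>S. r s * (case t of (i,j) \<Rightarrow> coeff (coeff (m s) i) j)) = 0"
    by blast
  then have rT: "(\<Sum>s\<in>S. r s * coeff (coeff (m s) i) j) = 0" if "(i,j) \<in> T" for i j
    using that by fastforce
  have bd: "bidegree_le (3*d*N) (m s)" if "s \<in> S" for s
  proof -
    obtain i j k where s: "s = (i,j,k)" by (cases s)
    have "bidegree_le (d*i + d*j + d*k) (m s)"
      unfolding s m_def using d by (auto intro!: bidegree_le_mult bidegree_le_power)
    moreover have "d*i + d*j + d*k \<le> d*N + d*N + d*N"
      using that by (intro add_mono mult_le_mono) (auto simp: s S_def)
    ultimately show ?thesis by (auto intro: bidegree_le_mono)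
  qed
  define H where "H = (\<Sum>s\<in>S. case s of (i,j,k) \<Rightarrow> monom (monom (monom (r s) i) j) k)"
  have "coeff (coeff (coeff H k) j) i = r (i,j,k)" if "(i,j,k) \<in> S" for i j k
  proof -
    have "coeff (coeff (coeff H k) j) i = (\<Sum>s\<in>S. if s = (i,j,k) then r s else 0)"
      unfolding H_def coeff_sum by (intro sum.cong) (auto simp: split: prod.splits)
    then show ?thesis using that fin by simp
  qed
  then have "H \<noteq> 0" using r by force
  moreover have "eval3 a b c H = 0"
  proof -
    interpret e: comm_ring_hom "eval3 a b c" by (rule comm_ring_hom_eval3)
    have ev: "eval3 a b c H = (\<Sum>s\<in>S. constK (r s) * m s)"
      unfolding H_def e.hom_sum
      by (intro sum.cong) (auto simp: eval3_monom m_def mult.assoc split: prod.splits)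
    show ?thesis
    proof (rule poly_eqI, rule poly_eqI)
      fix i j
      have "coeff (coeff (eval3 a b c H) i) j = (\<Sum>s\<in>S. r s * coeff (coeff (m s) i) j)"
        by (simp add: ev coeff_sum constK_mult)
      also have "\<dots> = 0"
      proof (cases "(i,j) \<in> T")
        case False
        have "coeff (coeff (m s) i) j = 0" if "s \<in> S" for s
        proof (cases "i \<le> 3*d*N")
          case True
          with False have "j > 3*d*N" by (simp add: T_def)
          then show ?thesis
            using bd[OF that] unfolding bidegree_le_def by (intro coeff_eq_0) (meson le_less_trans)
        next
          case False
          then have "coeff (m s) i = 0"
            using bd[OF that] unfolding bidegree_le_def by (intro coeff_eq_0) auto
          then show ?thesis by simp
        qed
        then show ?thesis by simp
      qed (rule rT)
      finally show "coeff (coeff (eval3 a b c H) i) j = coeff (coeff 0 i) j" by simp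
    qed
  qed
  ultimately show ?thesis by blast
qed

section \<open>Primes in subalgebras and the ideal of relations\<close>

definition subalgebra :: "'a::idom poly poly set \<Rightarrow> bool" where
  "subalgebra B \<longleftrightarrow> range constK \<subseteq> B \<and> (\<forall>a\<in>B. \<forall>b\<in>B. a + b \<in> B \<and> a * b \<in> B)"

text \<open>Prime ideals stated for bare sets, without a ring record, so that they can be taken in
  the full polynomial ring as well as in a subalgebra. In a subalgebra, closure under negation comes
  from multiplication by the constant -1.\<close>

definition prime_in :: "'r::comm_ring_1 set \<Rightarrow> 'r set \<Rightarrow> bool" where
  "prime_in B q \<longleftrightarrow> q \<subseteq> B \<and> 0 \<in> q \<and> 1 \<notin> q \<and> (\<forall>a\<in>q. \<forall>b\<in>q. a + b \<in> q) \<and> (\<forall>a\<in>q. \<forall>b\<in>B. b * a \<in> q) \<and>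
     (\<forall>a\<in>B. \<forall>b\<in>B. a * b \<in> q \<longrightarrow> a \<in> q \<or> b \<in> q)"

lemma subalgebra_poly_closed:
  assumes B: "subalgebra B" and "\<And>r. e r \<in> B" "e 0 = 0" "x \<in> B"
  shows "poly (map_poly e H) x \<in> B"
proof (induction H)
  case 0
  then show ?case using assms by (metis map_poly_0 poly_0)
next
  case (pCons r H)
  then show ?case using assms by (simp add: Polynomial.map_poly_pCons subalgebra_def)
qed

text \<open>Dividing by the powers of \<open>x\<close> is possible modulo \<open>q\<close>, and what remains is congruent to its
  lowest coefficient modulo \<open>q'\<close>.\<close>

lemma prime_in_lowest_coeff:
  fixes e :: "'r::zero \<Rightarrow> 'a::idom poly poly"
  assumes B: "subalgebra B" and q: "prime_in B q" and q': "prime_in B q'" and "q \<subseteq> q'"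
    and e: "\<And>r. e r \<in> B" "e 0 = 0" and x: "x \<in> q'" "x \<notin> q"
    and H: "H \<noteq> 0" "poly (map_poly e H) x \<in> q"
  shows "\<exists>r. r \<noteq> 0 \<and> e r \<in> q'"
  using H
proof (induction H)
  case 0
  then show ?case by simp
next
  case (pCons r H)
  have xB: "x \<in> B" using x q' by (auto simp: prime_in_def)
  define s where "s = poly (map_poly e H) x"
  have s: "s \<in> B" unfolding s_def by (intro subalgebra_poly_closed B e xB)
  have rs: "e r + x * s \<in> q" using pCons.prems e(2) by (simp add: Polynomial.map_poly_pCons s_def)
  show ?case
  proof (cases "r = 0")
    case True
    then have "x * s \<in> q" using rs e by simp
    then have "s \<in> q" using q x xB s by (auto simp: prime_in_def)
    then show ?thesis using pCons True by (auto simp: s_def)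
  next
    case False
    interpret c0: comm_ring_hom "constK :: 'a \<Rightarrow> _" by (rule comm_ring_hom_constK)
    \<comment> \<open>Subtracting \<open>x * s\<close> has to go through addition and multiples,
      hence the detour over -1 as an element of \<open>B\<close>.\<close>
    have "-1 = (constK (-1) :: 'a poly poly)"
      using c0.hom_add[of 1 "-1"] by (intro minus_unique) simp
    then have "-1 \<in> B" using B by (auto simp: subalgebra_def)
    moreover have "s * x \<in> q'" using q' x s by (auto simp: prime_in_def)
    ultimately have "(-1) * (s * x) \<in> q'" using q' unfolding prime_in_def by blast
    moreover have "e r + x * s \<in> q'" using rs \<open>q \<subseteq> q'\<close> by blast
    ultimately have "(e r + x * s) + (-1) * (s * x) \<in> q'" using q' unfolding prime_in_def by blast
    then show ?thesis using False by (auto simp: mult.commute)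
  qed
qed

text \<open>Coquand and Lombardi's argument: the lowest coefficients of an algebraic relation between
  elements that separate the primes lead to a nonzero constant in the largest prime.\<close>

lemma no_prime_chain4:
  fixes B :: "'a::field poly poly set"
  assumes B: "subalgebra B" and q: "prime_in B q0" "prime_in B q1" "prime_in B q2" "prime_in B q3"
    and sub: "q0 \<subset> q1" "q1 \<subset> q2" "q2 \<subset> q3"
  shows False
proof -
  obtain x1 x2 x3 where x: "x1 \<in> q1" "x1 \<notin> q0" "x2 \<in> q2" "x2 \<notin> q1" "x3 \<in> q3" "x3 \<notin> q2"
    using sub by blast
  then have xB: "x1 \<in> B" "x2 \<in> B" "x3 \<in> B" using q by (auto simp: prime_in_def)
  interpret c0: comm_ring_hom "constK :: 'a \<Rightarrow> _" by (rule comm_ring_hom_constK)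
  interpret c1: comm_ring_hom "eval1 x3" by (rule comm_ring_hom_eval1)
  interpret c2: comm_ring_hom "eval2 x3 x2" by (rule comm_ring_hom_eval2)
  have e0: "constK r \<in> B" for r using B by (auto simp: subalgebra_def)
  have e1: "eval1 x3 r \<in> B" for r unfolding eval1_def using e0 xB by (intro subalgebra_poly_closed B) auto
  have e2: "eval2 x3 x2 r \<in> B" for r unfolding eval2_def using e1 xB by (intro subalgebra_poly_closed B) auto
  \<comment> \<open>The outermost variable receives \<open>x1\<close>, which separates the two
    smallest primes. Lowest coefficients then drop \<open>x1\<close>, \<open>x2\<close>,
    \<open>x3\<close> in this order while the prime grows from \<open>q0\<close> to
    \<open>q3\<close>.\<close>
  obtain H where H: "H \<noteq> 0" "eval3 x3 x2 x1 H = 0" using algebraic_dependence by blast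
  have "0 \<in> q0" using q(1) by (simp add: prime_in_def)
  then obtain h where h: "h \<noteq> 0" "eval2 x3 x2 h \<in> q1"
    using prime_in_lowest_coeff[where e = "eval2 x3 x2", OF B q(1,2) _ e2 c2.hom_zero x(1,2) H(1)] H(2) sub
    unfolding eval3_def by auto
  then obtain p where p: "p \<noteq> 0" "eval1 x3 p \<in> q2"
    using prime_in_lowest_coeff[where e = "eval1 x3", OF B q(2,3) _ e1 c1.hom_zero x(3,4) h(1)] sub
    unfolding eval2_def by auto
  then obtain r where r: "r \<noteq> 0" "constK r \<in> q3"
    using prime_in_lowest_coeff[where e = constK, OF B q(3,4) _ e0 c0.hom_zero x(5,6) p(1)] sub
    unfolding eval1_def by auto
  then have "constK (inverse r) * constK r \<in> q3" using q(4) e0 unfolding prime_in_def by blast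
  moreover have "constK (inverse r) * constK r = 1" using r(1) by (simp add: constK_def)
  ultimately show False using q(4) by (simp add: prime_in_def)
qed

text \<open>A kernel element of least degree has an irreducible factor \<open>F\<close> in the
  kernel, since the target is a domain. Pseudo-division of a kernel element \<open>G\<close> by
  \<open>F\<close> leaves remainder 0 by minimality, so \<open>F\<close> divides
  \<open>a * G\<close> with \<open>a\<close> a nonzero coefficient. As \<open>F\<close> is prime and
  of positive degree, it divides \<open>G\<close>.\<close>

lemma kernel_principal:
  fixes \<Psi> :: "'r::ufd poly \<Rightarrow> 'd::idom"
  assumes "comm_ring_hom \<Psi>" and inj: "\<And>r. \<Psi> [:r:] = 0 \<Longrightarrow> r = 0"
    and H: "H \<noteq> 0" "\<Psi> H = 0"
  shows "\<exists>F. irreducible F \<and> \<Psi> F = 0 \<and> degree F \<ge> 1 \<and> (\<forall>G. \<Psi> G = 0 \<longrightarrow> F dvd G)"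
proof -
  interpret comm_ring_hom \<Psi> by fact
  define N where "N = (LEAST n. \<exists>F. F \<noteq> 0 \<and> \<Psi> F = 0 \<and> degree F = n)"
  have "\<exists>F. F \<noteq> 0 \<and> \<Psi> F = 0 \<and> degree F = N"
    unfolding N_def by (rule LeastI[of _ "degree H"]) (use H in blast)
  then obtain E where E: "E \<noteq> 0" "\<Psi> E = 0" "degree E = N" by blast
  have min: "N \<le> degree G" if "G \<noteq> 0" "\<Psi> G = 0" for G
    unfolding N_def by (rule Least_le) (use that in blast)
  have deg: "degree G \<ge> 1" if "G \<noteq> 0" "\<Psi> G = 0" for G
  proof (rule ccontr)
    assume "\<not> degree G \<ge> 1"
    then have "degree G = 0" by simp
    then obtain r where "G = [:r:]" by (rule degree_eq_zeroE)
    then show False using that inj by auto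
  qed
  have "\<not> E dvd 1"
  proof
    assume "E dvd 1"
    then obtain k where "1 = E * k" by (rule dvdE)
    then have "\<Psi> 1 = \<Psi> E * \<Psi> k" by (metis hom_mult)
    then show False using E(2) by simp
  qed
  then obtain A where A: "mset_factors A E" using mset_factors_exist E by blast
  have "\<Psi> (prod_mset A) = 0 \<Longrightarrow> \<exists>F. F \<in># A \<and> \<Psi> F = 0"
    by (induction A) (auto simp: hom_mult)
  then obtain F where F: "F \<in># A" "\<Psi> F = 0" using E(2) mset_factorsD(3)[OF A] by auto
  then have irr: "irreducible F" using A by auto
  then have F0: "F \<noteq> 0" by auto
  have "F dvd E" using A F by (auto intro: mset_factors_imp_dvd)
  then have dF: "degree F \<le> N" using E dvd_imp_degree_le by metis
  have "F dvd G" if G: "\<Psi> G = 0" for G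
  proof -
    obtain a s where as: "a \<noteq> 0" "smult a G = F * s + pseudo_mod G F"
      using pseudo_mod(1)[OF F0] by blast
    have "\<Psi> (smult a G) = \<Psi> [:a:] * \<Psi> G" by (simp flip: hom_mult)
    then have "\<Psi> (pseudo_mod G F) = 0" using as(2) G F by (simp add: hom_add hom_mult)
    then have "pseudo_mod G F = 0"
      using pseudo_mod(2)[OF F0, of G] min[of "pseudo_mod G F"] dF by linarith
    then have "F dvd [:a:] * G" using as by simp
    moreover have "prime_elem F" using irr by simp
    ultimately have "F dvd [:a:] \<or> F dvd G" by (rule prime_elem_dvd_multD[rotated])
    moreover have "\<not> F dvd [:a:]"
    proof
      assume "F dvd [:a:]"
      then have "degree F \<le> degree [:a:]" using as(1) by (intro dvd_imp_degree_le) auto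
      then show False using deg[OF F0 F(2)] by simp
    qed
    ultimately show ?thesis by blast
  qed
  then show ?thesis using irr F deg[OF F0 F(2)] by blast
qed

section \<open>Zero-free polynomials and injectivity\<close>

lemma eval_at_map_poly: "eval_at x y h = poly (map_poly (\<lambda>p. poly p x) h) y"
  unfolding eval_at_def by (induction h) (simp_all add: Polynomial.map_poly_pCons)

text \<open>An elementary case of the Nullstellensatz. At a value of x where the leading coefficient
  survives, the specialized polynomial keeps its degree in y and has no root, so that degree is 0.
  What remains is a polynomial in x without roots.\<close>

lemma zero_free_constant:
  fixes h :: "'a::field_char_0 poly poly"
  assumes ac: "alg_closed TYPE('a)" and nz: "\<And>x y. eval_at x y h \<noteq> 0"
  shows "\<exists>c. c \<noteq> 0 \<and> h = constK c"
proof -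
  have root: "degree p = 0" if "\<And>z. poly p z \<noteq> 0" for p :: "'a poly"
    using ac that unfolding alg_closed_def by (metis One_nat_def not_less_eq_eq le_zero_eq zero_le)
  have h0: "h \<noteq> 0" using nz by (auto simp: eval_at_def)
  then have "finite {x. poly (lead_coeff h) x = 0}" by (intro poly_roots_finite) simp
  then obtain x where x: "poly (lead_coeff h) x \<noteq> 0"
    using infinite_UNIV_char_0[where 'a='a] ex_new_if_finite by blast
  have "degree (map_poly (\<lambda>p. poly p x) h) = degree h"
    using x by (intro map_poly_degree_eq) auto
  moreover have "degree (map_poly (\<lambda>p. poly p x) h) = 0"
    using nz by (intro root) (simp flip: eval_at_map_poly)
  ultimately obtain p where p: "h = [:p:]" by (metis degree_eq_zeroE)
  have "degree p = 0" using nz by (intro root) (simp add: p eval_at_def)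
  then obtain c where "p = [:c:]" by (metis degree_eq_zeroE)
  then show ?thesis using h0 by (auto simp: p constK_def)
qed

text \<open>Because the Jacobian is nonzero, the kernel is stable under both partial derivatives. A
  nonzero kernel element could then be differentiated down to a nonzero constant, but
  \<open>f\<close> fixes constants.\<close>

lemma endo_inj:
  fixes f :: "'a::field_char_0 poly poly \<Rightarrow> 'a poly poly"
  assumes f: "is_K_alg_endo f" and j: "jac (f varX) (f varY) \<noteq> 0" and "f h = 0"
  shows "h = 0"
proof (rule ccontr)
  assume h0: "h \<noteq> 0"
  interpret f: comm_ring_hom f by (rule endo_comm_ring_hom[OF f])
  define S where "S = {h. f h = 0}"
  have S: "dX h \<in> S" "dY h \<in> S" if "h \<in> S" for h
  proof -
    have f0: "f h = 0" using that by (simp add: S_def)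
    have 1: "f (dX h) * dX (f varX) + f (dY h) * dX (f varY) = 0"
      using chain_rule2[OF f derivation_dX, of h] f0 derivation_0[OF derivation_dX[where 'a='a]] by simp
    have 2: "f (dX h) * dY (f varX) + f (dY h) * dY (f varY) = 0"
      using chain_rule2[OF f derivation_dY, of h] f0 derivation_0[OF derivation_dY[where 'a='a]] by simp
    \<comment> \<open>Cramer's rule for the linear system formed by the two equations above, whose
      right-hand sides are 0.\<close>
    have "f (dX h) * jac (f varX) (f varY) =
      (f (dX h) * dX (f varX) + f (dY h) * dX (f varY)) * dY (f varY) -
      (f (dX h) * dY (f varX) + f (dY h) * dY (f varY)) * dX (f varY)"
      by (simp add: jac_def algebra_simps)
    then show "dX h \<in> S" using j by (simp add: 1 2 S_def)
    have "f (dY h) * jac (f varX) (f varY) =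
      (f (dX h) * dY (f varX) + f (dY h) * dY (f varY)) * dX (f varX) -
      (f (dX h) * dX (f varX) + f (dY h) * dX (f varY)) * dY (f varX)"
      by (simp add: jac_def algebra_simps)
    then show "dY h \<in> S" using j by (simp add: 1 2 S_def)
  qed
  have hS: "h \<in> S" using \<open>f h = 0\<close> by (simp add: S_def)
  obtain h' where h': "h' \<in> S" "h' \<noteq> 0" "degree h' = 0"
    using pderiv_closed_degree[OF S(2)[unfolded dY_def] hS h0 le0] by blast
  then obtain p where p: "h' = [:p:]" by (metis degree_eq_zeroE)
  define S' where "S' = {p. [:p:] \<in> S}"
  have S': "pderiv p \<in> S'" if "p \<in> S'" for p
    using S(1)[of "[:p:]"] that by (simp add: S'_def)
  obtain p' where p': "p' \<in> S'" "p' \<noteq> 0" "degree p' = 0"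
    using pderiv_closed_degree[OF S' _ _ le0, of p] h' p by (auto simp: S'_def)
  from p'(3) obtain c where c: "p' = [:c:]" by (rule degree_eq_zeroE)
  then have "f (constK c) = 0" using p'(1) by (simp add: S'_def S_def constK_def)
  then show False using p'(2) c f by (simp add: endo_constK) (simp add: constK_def)
qed

subsection \<open>Keller maps whose image contains a coordinate\<close>

lemma prime_in_kernel:
  fixes h :: "'r::comm_ring_1 \<Rightarrow> 'd::idom"
  assumes "comm_ring_hom h"
  shows "prime_in UNIV {x. h x = 0}"
proof -
  interpret comm_ring_hom h by fact
  show ?thesis by (auto simp: prime_in_def hom_add hom_mult)
qed

lemma prime_in_multiples:
  fixes g :: "'r::idom"
  assumes "prime_elem g"
  shows "prime_in UNIV {h. g dvd h}"
  using assms prime_elem_not_unit[OF assms] prime_elem_dvd_multD[OF assms]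
  by (auto simp: prime_in_def)

text \<open>Degrees add over a domain: the degree in y forces both factors into K[x], and there
  total degree 1 leaves one factor constant.\<close>

lemma linear_factors_constant:
  fixes a b :: "'a::field poly poly"
  assumes "a * b = varX - constK l"
  shows "\<exists>k. k \<noteq> 0 \<and> (a = constK k \<or> b = constK k)"
proof -
  have ab: "a * b = [:[:-l, 1:]:]" using assms by (simp add: varX_def constK_def)
  then have nz: "a \<noteq> 0" "b \<noteq> 0" by auto
  have "degree a + degree b = 0"
    using ab degree_mult_eq[OF nz] by simp
  then obtain p q where pq: "a = [:p:]" "b = [:q:]" by (metis add_is_0 degree_eq_zeroE)
  then have pq1: "p * q = [:-l, 1:]" using ab by (simp add: mult.commute)
  have nz': "p \<noteq> 0" "q \<noteq> 0" using nz pq by auto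
  have "degree p + degree q = 1"
    using pq1 degree_mult_eq[OF nz'] by simp
  then have "degree p = 0 \<or> degree q = 0" by auto
  then show ?thesis
    using nz' unfolding pq constK_def by (metis degree_eq_zeroE pCons_0_0)
qed

lemma range_subalgebra:
  assumes "is_K_alg_endo f"
  shows "subalgebra (range f)"
proof -
  interpret comm_ring_hom f by (rule endo_comm_ring_hom[OF assms])
  have "constK c \<in> range f" for c using endo_constK[OF assms] by (metis rangeI)
  moreover have "f a + f b \<in> range f" "f a * f b \<in> range f" for a b
    by (metis hom_add rangeI, metis hom_mult rangeI)
  ultimately show ?thesis by (auto simp: subalgebra_def)
qed

lemma surj_if_varX_varY:
  assumes f: "is_K_alg_endo f" and "varX \<in> range f" "varY \<in> range f"
  shows "surj f"
proof -
  have "h \<in> range f" for h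
    using range_subalgebra[OF f] assms
    by (induction h rule: bipoly_induct) (auto simp: subalgebra_def)
  then show ?thesis by blast
qed

text \<open>Differentiating \<open>f g = varX\<close> in x and in y gives a linear system for
  \<open>f (dX g)\<close> and \<open>f (dY g)\<close>. Its determinant is the constant
  \<open>c\<close>, so Cramer's rule writes the y-derivatives of P and Q as elements of the range;
  the chain rule extends this to all of it.\<close>

lemma endo_range_dY_closed:
  fixes f :: "'a::field_char_0 poly poly \<Rightarrow> 'a poly poly"
  assumes f: "is_K_alg_endo f" and c: "jac (f varX) (f varY) = constK c" "c \<noteq> 0"
    and g: "f g = varX" and "h \<in> range f"
  shows "dY h \<in> range f"
proof -
  interpret f: comm_ring_hom f by (rule endo_comm_ring_hom[OF f])
  have 1: "f (dX g) * dX (f varX) + f (dY g) * dX (f varY) = 1"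
    using chain_rule2[OF f derivation_dX, of g] g by simp
  have 2: "f (dX g) * dY (f varX) + f (dY g) * dY (f varY) = 0"
    using chain_rule2[OF f derivation_dY, of g] g by simp
  have "f (dX g) * jac (f varX) (f varY) =
    (f (dX g) * dX (f varX) + f (dY g) * dX (f varY)) * dY (f varY) -
    (f (dX g) * dY (f varX) + f (dY g) * dY (f varY)) * dX (f varY)"
    by (simp add: jac_def algebra_simps)
  then have dQ: "dY (f varY) = f (dX g * constK c)"
    by (simp add: 1 2 c f.hom_mult endo_constK[OF f])
  have "f (- dY g) * jac (f varX) (f varY) =
    (f (dX g) * dX (f varX) + f (dY g) * dX (f varY)) * dY (f varX) -
    (f (dX g) * dY (f varX) + f (dY g) * dY (f varY)) * dX (f varX)"
    by (simp add: jac_def algebra_simps f.hom_uminus)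
  then have dP: "dY (f varX) = f (- (dY g * constK c))"
    by (simp add: 1 2 c f.hom_mult endo_constK[OF f] f.hom_uminus)
  obtain k where "h = f k" using \<open>h \<in> range f\<close> by blast
  then have "dY h = f (dX k * (- (dY g * constK c)) + dY k * (dX g * constK c))"
    using chain_rule2[OF f derivation_dY, of k] by (simp add: dP dQ f.hom_add f.hom_mult f.hom_minus f.hom_uminus)
  then show ?thesis by blast
qed

text \<open>Since \<open>f\<close> is injective, it identifies its source with \<open>A\<close>. The
  chain of four primes is therefore built in the full source ring, as preimages of the ideals of
  \<open>A\<close>.\<close>

lemma endo_surj_if_varX:
  fixes f :: "'a::field_char_0 poly poly \<Rightarrow> 'a poly poly"
  assumes ac: "alg_closed TYPE('a)" and f: "is_K_alg_endo f"
    and c: "jac (f varX) (f varY) = constK c" "c \<noteq> 0" and g: "f g = varX"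
  shows "surj f"
proof -
  interpret f: comm_ring_hom f by (rule endo_comm_ring_hom[OF f])
  have j: "jac (f varX) (f varY) \<noteq> 0" using c by (simp add: constK_def)
  note inj = endo_inj[OF f j]
  define A where "A = range f"
  have sub: "subalgebra A" unfolding A_def by (rule range_subalgebra[OF f])
  have A_diff: "a - b \<in> A" if "a \<in> A" "b \<in> A" for a b
  proof -
    from that obtain h k where "a = f h" "b = f k" by (auto simp: A_def)
    then have "a - b = f (h - k)" by (simp add: f.hom_minus)
    then show ?thesis by (simp add: A_def)
  qed
  have A_coeff: "[:p:] \<in> A" for p
  proof (induction p)
    case 0
    have "f 0 \<in> A" unfolding A_def by (rule rangeI)
    then show ?case by simp
  next
    case (pCons a p)
    have "varX \<in> A" using g by (metis A_def rangeI)
    then have "constK a + varX * [:p:] \<in> A" using sub pCons unfolding subalgebra_def by blast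
    moreover have "[:pCons a p:] = constK a + varX * [:p:]" by (simp add: constK_def varX_def)
    ultimately show ?case by (simp only:)
  qed
  have dYA: "pderiv h \<in> A" if "h \<in> A" for h
    using endo_range_dY_closed[OF f c g] that by (simp add: A_def dY_def)
  \<comment> \<open>A nonzero Jacobian means that P or Q involves y; differentiating in y leads to
    an element of \<open>A\<close> of degree 1 in y, whose constant term lies in K[x] and can be
    removed.\<close>
  have "dY (f varX) \<noteq> 0 \<or> dY (f varY) \<noteq> 0" using j by (auto simp: jac_def)
  then obtain k where k: "k \<in> A" "pderiv k \<noteq> 0" by (auto simp: A_def dY_def)
  then have "k \<noteq> 0" "1 \<le> degree k" by (auto simp: pderiv_eq_0_iff)
  from pderiv_closed_degree[OF dYA k(1) this]
  obtain k' where k': "k' \<in> A" "degree k' = 1" by blast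
  obtain p0 p1 where p01: "k' = [:p0, p1:]" "p1 \<noteq> 0"
  proof (cases k')
    case (pCons p0 r)
    then have "r \<noteq> 0" "degree r = 0" using k' by (auto split: if_splits)
    then show ?thesis using that pCons by (metis degree_eq_zeroE pCons_0_0)
  qed
  have "[:p0, p1:] - [:p0:] \<in> A" using k' p01 by (intro A_diff A_coeff) simp
  then have p1: "[:0, p1:] \<in> A" by simp
  define N where "N = (LEAST n. \<exists>p. p \<noteq> 0 \<and> [:0, p:] \<in> A \<and> degree p = n)"
  have "\<exists>p. p \<noteq> 0 \<and> [:0, p:] \<in> A \<and> degree p = N"
    unfolding N_def by (rule LeastI[of _ "degree p1"]) (use p1 p01 in blast)
  then obtain p where p: "p \<noteq> 0" "[:0, p:] \<in> A" "degree p = N" by blast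
  have min: "N \<le> degree q" if "q \<noteq> 0" "[:0, q:] \<in> A" for q
    unfolding N_def by (rule Least_le) (use that in blast)
  have "degree p = 0"
  proof (rule ccontr)
    assume "degree p \<noteq> 0"
    then obtain l where l: "poly p l = 0" using ac unfolding alg_closed_def by (metis One_nat_def Suc_leI neq0_conv)
    then obtain p2 where p2: "p = [:-l, 1:] * p2" by (metis dvdE poly_eq_0_iff_dvd)
    then have "p2 \<noteq> 0" using p(1) by auto
    moreover have "degree p = 1 + degree p2"
      unfolding p2 using \<open>p2 \<noteq> 0\<close> by (subst degree_mult_eq) simp_all
    ultimately have p2': "p2 \<noteq> 0" "degree p2 < N" using p(3) by simp_all
    obtain \<alpha> where \<alpha>: "f \<alpha> = [:0, p:]" using p(2) unfolding A_def by (metis rangeE)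
    define \<gamma> where "\<gamma> = g - constK l"
    have \<gamma>: "f \<gamma> = varX - constK l" by (simp add: \<gamma>_def f.hom_minus g endo_constK[OF f])
    have \<xi>: "varX - constK l = [:[:-l, 1:]:]" by (simp add: varX_def constK_def)
    \<comment> \<open>A factorization of \<gamma> maps to one of x - l, where one factor is
      constant; injectivity pulls the constant back.\<close>
    have irr: "irreducible \<gamma>"
    proof (rule irreducibleI)
      show "\<gamma> \<noteq> 0" using \<gamma> \<xi> by auto
      show "\<not> \<gamma> dvd 1"
      proof
        assume "\<gamma> dvd 1"
        then obtain k where "1 = \<gamma> * k" by (rule dvdE)
        then have "1 = f \<gamma> * f k" by (metis f.hom_mult f.hom_one)
        from arg_cong[OF this, of "eval_at l 0"] show False by (simp add: \<gamma> \<xi> eval_at_def)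
      qed
      fix a b assume "\<gamma> = a * b"
      then have "f a * f b = varX - constK l" using \<gamma> by (simp add: f.hom_mult)
      from linear_factors_constant[OF this] obtain k where k: "k \<noteq> 0" "f a = constK k \<or> f b = constK k" by blast
      have "h dvd 1" if "f h = constK k" for h
      proof -
        have "f (h - constK k) = 0" using that by (simp add: f.hom_minus endo_constK[OF f])
        then have "h = constK k" using inj by fastforce
        then have "1 = h * constK (inverse k)" using k(1) by (simp add: constK_def)
        then show ?thesis by (rule dvdI)
      qed
      then show "a dvd 1 \<or> b dvd 1" using k by blast
    qed
    \<comment> \<open>Divisibility would put \<open>[:0, p2:]\<close> into \<open>A\<close>, against
      the least degree of \<open>p\<close>.\<close>
    have ndvd: "\<not> \<gamma> dvd \<alpha>"
    proof
      assume "\<gamma> dvd \<alpha>"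
      then obtain \<beta> where "\<alpha> = \<gamma> * \<beta>" by (rule dvdE)
      then have "[:[:-l, 1:]:] * f \<beta> = [:[:-l, 1:]:] * [:0, p2:]"
        using \<alpha> p2 by (simp add: f.hom_mult \<gamma> \<xi>)
      then have "f \<beta> = [:0, p2:]" by (subst (asm) mult_cancel_left) simp
      then have "[:0, p2:] \<in> A" by (metis A_def rangeI)
      then show False using min[of p2] p2' by simp
    qed
    \<comment> \<open>Restriction of \<open>f h\<close> to the line x = l; its kernel is the
      preimage of (x - l) K[x,y]. It contains \<alpha>, as \<open>p\<close> vanishes at
      \<open>l\<close>, and so it is larger than the multiples of \<gamma>.\<close>
    define \<phi> where "\<phi> h = map_poly (\<lambda>p. poly p l) (f h)" for h
    interpret ev: comm_ring_hom "\<lambda>p. poly p l" by unfold_locales simp_all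
    interpret mev: map_poly_comm_ring_hom "\<lambda>p. poly p l" ..
    interpret \<phi>: comm_ring_hom \<phi>
      by unfold_locales (simp_all add: \<phi>_def f.hom_add f.hom_mult mev.hom_add mev.hom_mult)
    have pd: "pderiv (map_poly (\<lambda>p. poly p l) h) = map_poly (\<lambda>p. poly p l) (pderiv h)" for h :: "'a poly poly"
      by (induction h) (simp_all add: Polynomial.map_poly_pCons pderiv_pCons mev.hom_add)
    have q2: "prime_in UNIV {h. \<phi> h = 0}" by (rule prime_in_kernel) (rule \<phi>.comm_ring_hom_axioms)
    have q3: "prime_in UNIV {h. poly (\<phi> h) 0 = 0}"
      by (rule prime_in_kernel) (unfold_locales, simp_all add: \<phi>.hom_add \<phi>.hom_mult)
    have q1: "prime_in UNIV {h. \<gamma> dvd h}" using irr by (intro prime_in_multiples) simp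
    have q0: "prime_in UNIV {0 :: 'a poly poly}" by (simp add: prime_in_def)
    have \<phi>K: "\<phi> (constK k) = [:k:]" for k
      by (simp add: \<phi>_def endo_constK[OF f]) (simp add: constK_def Polynomial.map_poly_pCons)
    have \<phi>\<gamma>: "\<phi> \<gamma> = 0" by (simp add: \<phi>_def \<gamma> \<xi> Polynomial.map_poly_pCons)
    have s01: "{0} \<subset> {h. \<gamma> dvd h}" using irr by auto
    have "\<phi> \<alpha> = 0" by (simp add: \<phi>_def \<alpha> Polynomial.map_poly_pCons l)
    then have s12: "{h. \<gamma> dvd h} \<subset> {h. \<phi> h = 0}"
      using ndvd by (auto simp: \<phi>.hom_mult \<phi>\<gamma> elim!: dvdE)
    \<comment> \<open>Equality would make P and Q constant on the line, so their y-derivatives, and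
      with them the Jacobian, would vanish there.\<close>
    have "{h. \<phi> h = 0} \<noteq> {h. poly (\<phi> h) 0 = 0}"
    proof
      assume eq: "{h. \<phi> h = 0} = {h. poly (\<phi> h) 0 = 0}"
      have z: "pderiv (\<phi> h) = 0" for h
      proof -
        have "poly (\<phi> (h - constK (poly (\<phi> h) 0))) 0 = 0" by (simp add: \<phi>.hom_minus \<phi>K)
        then have "\<phi> (h - constK (poly (\<phi> h) 0)) = 0" using eq by blast
        then have "\<phi> h = [:poly (\<phi> h) 0:]" by (simp add: \<phi>.hom_minus \<phi>K)
        then show ?thesis by (metis pderiv_singleton)
      qed
      have "map_poly (\<lambda>p. poly p l) (jac (f varX) (f varY)) = 0"
        using z[of varX] z[of varY]
        by (simp add: jac_def mev.hom_minus mev.hom_mult dY_def \<phi>_def pd)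
      then show False using c by (simp add: constK_def Polynomial.map_poly_pCons)
    qed
    then have s23: "{h. \<phi> h = 0} \<subset> {h. poly (\<phi> h) 0 = 0}" by auto
    have "subalgebra (UNIV :: 'a poly poly set)" by (simp add: subalgebra_def)
    from no_prime_chain4[OF this q0 q1 q2 q3 s01 s12 s23] show False .
  qed
  then obtain k where k: "p = [:k:]" "k \<noteq> 0" using p(1) by (metis degree_eq_zeroE pCons_0_0)
  have "constK (inverse k) \<in> A" using sub by (auto simp: subalgebra_def)
  then have "constK (inverse k) * [:0, p:] \<in> A" using sub p(2) by (simp only: subalgebra_def)
  moreover have "constK (inverse k) * [:0, p:] = varY" using k by (simp add: varY_def constK_def)
  ultimately have "varY \<in> range f" by (simp only: A_def)
  moreover have "varX \<in> range f" using g by (metis rangeI)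
  ultimately show ?thesis by (intro surj_if_varX_varY f)
qed

subsection \<open>Singular points of the subalgebra\<close>

lemma K_subalg_gen_eq_range:
  assumes f: "is_K_alg_endo f"
  shows "K_subalg_gen {f varX, f varY, w} = range (\<lambda>H. poly (map_poly f H) w)"
proof -
  interpret f: comm_ring_hom f by (rule endo_comm_ring_hom[OF f])
  define \<Psi> where "\<Psi> = (\<lambda>H. poly (map_poly f H) w)"
  interpret \<Psi>: comm_ring_hom \<Psi> unfolding \<Psi>_def by (intro comm_ring_hom_eval endo_comm_ring_hom f)
  have C: "\<Psi> [:a:] = f a" for a by (simp add: \<Psi>_def Polynomial.map_poly_pCons)
  have "\<Psi> [:0, 1:] = w" by (simp add: \<Psi>_def Polynomial.map_poly_pCons)
  then have w: "w \<in> range \<Psi>" by (metis rangeI)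
  have "b \<in> range \<Psi>" if "b \<in> K_subalg_gen {f varX, f varY, w}" for b
    using that
  proof induction
    case (const c)
    then show ?case using C endo_constK[OF f] by (metis rangeI)
  next
    case (gen g)
    then show ?case using C w by (auto simp: image_iff) (metis C)+
  next
    case (add a b)
    then obtain H H' where "a = \<Psi> H" "b = \<Psi> H'" by auto
    then have "a + b = \<Psi> (H + H')" by (simp add: \<Psi>.hom_add)
    then show ?case by simp
  next
    case (mult a b)
    then obtain H H' where "a = \<Psi> H" "b = \<Psi> H'" by auto
    then have "a * b = \<Psi> (H * H')" by (simp add: \<Psi>.hom_mult)
    then show ?case by simp
  qed
  moreover have fK: "f a \<in> K_subalg_gen {f varX, f varY, w}" for a
    by (induction a rule: bipoly_induct)
       (auto simp: endo_constK[OF f] f.hom_add f.hom_mult intro: K_subalg_gen.intros)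
  have "\<Psi> H \<in> K_subalg_gen {f varX, f varY, w}" for H
  proof (induction H)
    case 0
    then show ?case using fK[of 0] by simp
  next
    case (pCons a H)
    have "\<Psi> (pCons a H) = f a + w * \<Psi> H" by (simp add: \<Psi>_def Polynomial.map_poly_pCons)
    then show ?case using pCons fK by (auto intro: K_subalg_gen.intros)
  qed
  ultimately show ?thesis unfolding \<Psi>_def by blast
qed

section \<open>Ideals and dimension of localizations\<close>

lemma ring_of_set_simps:
  "carrier (ring_of_set S) = S" "x \<otimes>\<^bsub>ring_of_set S\<^esub> y = x * y" "x \<oplus>\<^bsub>ring_of_set S\<^esub> y = x + y"
  "\<zero>\<^bsub>ring_of_set S\<^esub> = 0" "\<one>\<^bsub>ring_of_set S\<^esub> = 1"
  by (simp_all add: ring_of_set_def)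

lemma ideal_ring_of_setI:
  assumes R: "ring (ring_of_set S)" and I: "I \<subseteq> S" "0 \<in> I"
    and add: "\<And>a b. a \<in> I \<Longrightarrow> b \<in> I \<Longrightarrow> a + b \<in> I"
    and minus: "\<And>a. a \<in> I \<Longrightarrow> - a \<in> I"
    and mult: "\<And>r a. r \<in> S \<Longrightarrow> a \<in> I \<Longrightarrow> r * a \<in> I"
  shows "ideal I (ring_of_set S)"
proof (rule idealI[OF R])
  interpret R: ring "ring_of_set S" by fact
  show "subgroup I (add_monoid (ring_of_set S))"
  proof (rule R.add.subgroupI)
    fix a assume a: "a \<in> I"
    then have "\<ominus>\<^bsub>ring_of_set S\<^esub> a = - a"
      using minus[OF a] I by (intro R.minus_equality) (auto simp: ring_of_set_simps)
    then show "\<ominus>\<^bsub>ring_of_set S\<^esub> a \<in> I" using minus[OF a] by simp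
  qed (use I add in \<open>auto simp: ring_of_set_simps\<close>)
  fix a r assume "a \<in> I" "r \<in> carrier (ring_of_set S)"
  then have "r * a \<in> I" using mult by (simp add: ring_of_set_simps)
  then show "r \<otimes>\<^bsub>ring_of_set S\<^esub> a \<in> I" "a \<otimes>\<^bsub>ring_of_set S\<^esub> r \<in> I"
    by (simp_all add: ring_of_set_simps mult.commute)
qed

lemma cring_ring_of_set:
  assumes "ring (ring_of_set S)"
  shows "cring (ring_of_set S)"
proof -
  interpret ring "ring_of_set S" by fact
  show ?thesis by unfold_locales (simp add: ring_of_set_simps mult.commute)
qed

text \<open>Primes of the localization are contracted to \<open>B\<close>. Strict inclusions stay
  strict because denominators are units there: a fraction separating two primes can be replaced by
  its numerator. A chain of length 3 would thus give four primes in \<open>B\<close>.\<close>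

lemma krull_dim_localization_le_2:
  fixes B :: "'a::field poly poly set"
  assumes B: "subalgebra B" and p: "0 \<in> p" "1 \<notin> p"
  shows "krull_dim (localization_at B p) \<le> 2"
  unfolding krull_dim_def
proof (rule Sup_least, clarify)
  fix n :: nat and ch :: "nat \<Rightarrow> 'a poly poly fract set"
  let ?R = "localization_at B p"
  assume prime: "\<forall>i\<le>n. primeideal (ch i) ?R" and strict: "\<forall>i<n. ch i \<subset> ch (Suc i)"
  have cB: "constK r \<in> B" for r using B by (auto simp: subalgebra_def)
  have B01: "0 \<in> B" "1 \<in> B" using cB[of 0] cB[of 1] by (simp_all add: constK_def)
  have simps: "carrier ?R = {Fract a s | a s. a \<in> B \<and> s \<in> B \<and> s \<notin> p}"
     "x \<otimes>\<^bsub>?R\<^esub> y = x * y" "x \<oplus>\<^bsub>?R\<^esub> y = x + y" "\<zero>\<^bsub>?R\<^esub> = 0" "\<one>\<^bsub>?R\<^esub> = 1" for x y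
    by (simp_all add: localization_at_def ring_of_set_simps)
  have BR: "Fract b 1 \<in> carrier ?R" if "b \<in> B" for b using that B01 p by (auto simp: simps)
  define q where "q i = {b \<in> B. Fract b 1 \<in> ch i}" for i
  have q: "prime_in B (q i)" if "i \<le> n" for i
  proof -
    interpret I: primeideal "ch i" ?R using prime that by blast
    show ?thesis unfolding prime_in_def
    proof (intro conjI ballI impI)
      show "q i \<subseteq> B" by (auto simp: q_def)
      show "0 \<in> q i" using additive_subgroup.zero_closed[OF I.is_additive_subgroup] B01 by (simp add: q_def simps(4) fract_collapse)
      show "1 \<notin> q i"
      proof
        assume "1 \<in> q i"
        then have "\<one>\<^bsub>?R\<^esub> \<in> ch i" by (simp add: q_def simps fract_collapse)
        then show False using I.one_imp_carrier I.I_notcarr by simp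
      qed
      fix a b assume a: "a \<in> q i"
      { assume "b \<in> q i"
        then show "a + b \<in> q i" using a additive_subgroup.a_closed[OF I.is_additive_subgroup, of "Fract a 1" "Fract b 1"] B
          by (auto simp: q_def simps subalgebra_def) }
      { assume "b \<in> B"
        then show "b * a \<in> q i" using a I.I_l_closed[of "Fract a 1" "Fract b 1"] B BR
          by (auto simp: q_def simps(2) subalgebra_def) }
    next
      fix a b assume "a \<in> B" "b \<in> B" "a * b \<in> q i"
      then show "a \<in> q i \<or> b \<in> q i" using I.I_prime[of "Fract a 1" "Fract b 1"] BR
        by (auto simp: q_def simps(2))
    qed
  qed
  have qs: "q i \<subset> q (Suc i)" if "i < n" for i
  proof -
    interpret I: primeideal "ch i" ?R using prime that by simp
    interpret J: primeideal "ch (Suc i)" ?R using prime that by simp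
    have sub: "ch i \<subset> ch (Suc i)" using strict that by blast
    then obtain x where x: "x \<in> ch (Suc i)" "x \<notin> ch i" by blast
    then have "x \<in> carrier ?R" using J.a_subset by blast
    then obtain a s where as: "x = Fract a s" "a \<in> B" "s \<in> B" "s \<notin> p" by (auto simp: simps)
    have s0: "s \<noteq> 0" using as p by auto
    have "Fract s 1 * x \<in> ch (Suc i)" using J.I_l_closed[OF x(1) BR[OF as(3)]] by (simp add: simps)
    moreover have "Fract s 1 * x = Fract a 1" using s0 by (simp add: as eq_fract)
    ultimately have "a \<in> q (Suc i)" using as by (simp add: q_def)
    moreover have "a \<notin> q i"
    proof
      assume "a \<in> q i"
      moreover have "Fract 1 s \<in> carrier ?R" using as B01 by (auto simp: simps)
      ultimately have "Fract 1 s * Fract a 1 \<in> ch i"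
        using I.I_l_closed[of "Fract a 1" "Fract 1 s"] by (simp add: simps(2) q_def)
      then show False using x as by simp
    qed
    ultimately show ?thesis using sub by (auto simp: q_def)
  qed
  have "n \<le> 2"
  proof (rule ccontr)
    assume "\<not> n \<le> 2"
    then have n: "0 < n" "1 < n" "2 < n" "3 \<le> n" by auto
    show False
      using no_prime_chain4[OF B q[of 0] q[of 1] q[of 2] q[of 3]] qs[OF n(1)] qs[OF n(2)] qs[OF n(3)] n
      by (auto simp: numeral_eq_Suc)
  qed
  then show "enat n \<le> 2" by (metis enat_ord_simps(1) numeral_eq_enat)
qed

text \<open>If all relations were singular at the point, then every linear form in the three partial
  derivatives would factor through the local ring, so the maximal ideal would need three generators.\<close>

lemma regular_ring_gradient:
  fixes f :: "'a::field poly poly \<Rightarrow> 'a poly poly" and x y :: 'a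
  assumes f: "is_K_alg_endo f" and reg: "regular_ring (K_subalg_gen {f varX, f varY, w})"
  defines "\<Psi> \<equiv> \<lambda>H. poly (map_poly f H) w"
  defines "E \<equiv> \<lambda>H. eval_at x y (\<Psi> H)"
  shows "\<exists>H. \<Psi> H = 0 \<and> \<not> (E (map_poly dX H) = 0 \<and> E (map_poly dY H) = 0 \<and> E (pderiv H) = 0)"
proof (rule ccontr)
  assume "\<not> ?thesis"
  then have sing: "E (map_poly dX H) = 0" "E (map_poly dY H) = 0" "E (pderiv H) = 0" if "\<Psi> H = 0" for H
    using that by blast+
  interpret f: comm_ring_hom f by (rule endo_comm_ring_hom[OF f])
  interpret \<Psi>: comm_ring_hom \<Psi> unfolding \<Psi>_def by (intro comm_ring_hom_eval endo_comm_ring_hom f)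
  interpret e: comm_ring_hom "eval_at x y" by (rule comm_ring_hom_eval_at)
  interpret E: comm_ring_hom E
    by unfold_locales (simp_all add: E_def \<Psi>.hom_add \<Psi>.hom_mult e.hom_add e.hom_mult)
  define B where "B = range \<Psi>"
  have B_eq: "K_subalg_gen {f varX, f varY, w} = B"
    using K_subalg_gen_eq_range[OF f] by (simp add: B_def \<Psi>_def)
  have \<Psi>B: "\<Psi> H \<in> B" for H by (simp add: B_def)
  have subB: "subalgebra B"
    unfolding subalgebra_def B_eq[symmetric] by (auto intro: K_subalg_gen.intros)
  define p where "p = {b \<in> B. eval_at x y b = 0}"
  have E\<Psi>: "\<Psi> H \<in> p \<longleftrightarrow> E H = 0" for H by (simp add: p_def E_def \<Psi>B)
  have noethB: "noetherian_ring (ring_of_set B)" using reg by (simp add: regular_ring_def B_eq)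
  interpret RB: cring "ring_of_set B"
    by (rule cring_ring_of_set) (rule noetherian_ring.axioms(1)[OF noethB])
  have "primeideal p (ring_of_set B)"
  proof (rule primeidealI)
    show "cring (ring_of_set B)" by (rule RB.is_cring)
    show "ideal p (ring_of_set B)"
    proof (rule ideal_ring_of_setI)
      show "ring (ring_of_set B)" by (rule RB.ring_axioms)
      show "p \<subseteq> B" by (auto simp: p_def)
      show "0 \<in> p" using E\<Psi>[of 0] by simp
      show "- a \<in> p" if a: "a \<in> p" for a
      proof -
        obtain H where "a = \<Psi> H" using a by (auto simp: p_def B_def)
        then show ?thesis using a E\<Psi>[of H] E\<Psi>[of "-H"] by (simp add: \<Psi>.hom_uminus E.hom_uminus)
      qed
    qed (use subB in \<open>auto simp: p_def subalgebra_def e.hom_add e.hom_mult\<close>)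
    have "1 \<notin> p" "1 \<in> B" using E\<Psi>[of 1] \<Psi>B[of 1] by simp_all
    then show "carrier (ring_of_set B) \<noteq> p" by (auto simp: ring_of_set_simps)
  qed (auto simp: ring_of_set_simps p_def e.hom_mult)
  define R where "R = localization_at B p"
  have "regular_local_ring R"
    using reg \<open>primeideal p (ring_of_set B)\<close> by (simp add: regular_ring_def B_eq R_def)
  then obtain m where noeth: "noetherian_ring R" and "cring R" and m: "maximalideal m R"
    and dim: "krull_dim R = enat (min_num_gens R m)"
    unfolding regular_local_ring_def local_ring_def by blast
  interpret R: cring R by fact
  interpret m: maximalideal m R by fact
  have simps: "carrier R = {Fract a s | a s. a \<in> B \<and> s \<in> B \<and> s \<notin> p}"
     "u \<otimes>\<^bsub>R\<^esub> v = u * v" "\<one>\<^bsub>R\<^esub> = 1" for u v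
    by (simp_all add: R_def localization_at_def ring_of_set_simps)
  have p01: "0 \<in> p" "1 \<notin> p" using E\<Psi>[of 0] E\<Psi>[of 1] by simp_all
  have carr: "\<exists>H S. z = Fract (\<Psi> H) (\<Psi> S) \<and> E S \<noteq> 0" if z: "z \<in> carrier R" for z
  proof -
    obtain a s where as: "z = Fract a s" "a \<in> B" "s \<in> B" "s \<notin> p" using z by (auto simp: simps(1))
    then obtain H S where "a = \<Psi> H" "s = \<Psi> S" by (auto simp: B_def)
    then show ?thesis using as E\<Psi> by blast
  qed
  have carr': "Fract (\<Psi> H) (\<Psi> S) \<in> carrier R" if "E S \<noteq> 0" for H S
    using that \<Psi>B E\<Psi> by (auto simp: simps)
  have nz: "\<Psi> S \<noteq> 0" if "E S \<noteq> 0" for S using that by (auto simp: E_def)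

  \<comment> \<open>Regularity enters here: the number of generators of \<open>m\<close> equals the
    dimension, which is at most 2. Finite generation, from the Noetherian property, ensures that the
    least number is attained.\<close>
  have "\<exists>G. finite G \<and> card G \<le> 2 \<and> G \<subseteq> carrier R \<and> genideal R G = m"
  proof -
    have "enat (min_num_gens R m) \<le> 2"
      using krull_dim_localization_le_2[OF subB p01] dim by (simp add: R_def)
    then have le2: "min_num_gens R m \<le> 2" by (simp add: numeral_eq_enat)
    obtain A where "A \<subseteq> carrier R" "finite A" "m = genideal R A"
      using noetherian_ring.finetely_gen[OF noeth m.is_ideal] by blast
    then have "\<exists>n G. finite G \<and> card G = n \<and> G \<subseteq> carrier R \<and> genideal R G = m" by blast
    from LeastI_ex[OF this] show ?thesis using le2 unfolding min_num_gens_def by auto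
  qed
  then obtain G where G: "finite G" "card G \<le> 2" "G \<subseteq> carrier R" "genideal R G = m" by blast

  define gr where "gr i H = E (if i = 0 then map_poly dX H else if i = 1 then map_poly dY H else pderiv H)"
    for i :: nat and H
  note ders = derivation_map_poly[OF derivation_dX] derivation_map_poly[OF derivation_dY] derivation_pderiv
  have gr_mult: "gr i (H * H') = gr i H * E H' + E H * gr i H'" for i H H'
    by (simp add: gr_def ders[THEN derivation_mult] E.hom_add E.hom_mult)
  have gr_add: "gr i (H + H') = gr i H + gr i H'" for i H H'
    by (simp add: gr_def ders[THEN derivation_add] E.hom_add)
  have gr_minus: "gr i (H - H') = gr i H - gr i H'" for i H H'
    by (simp add: gr_def ders[THEN derivation_diff] E.hom_minus)
  have gr_0: "gr i 0 = 0" for i by (simp add: gr_def)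
  have gr_ker: "gr i H = 0" if "\<Psi> H = 0" for i H
    using sing[OF that] by (simp add: gr_def)
  \<comment> \<open>A general linear form in the gradient at the image point; it is a derivation
    with values in K over the evaluation \<open>E\<close>, and by \<open>sing\<close> it kills all
    relations.\<close>
  define L where "L l H = (\<Sum>i<3. l i * gr i H)" for l :: "nat \<Rightarrow> 'a" and H
  have L_mult: "L l (H * H') = L l H * E H' + E H * L l H'" for l H H'
    by (simp add: L_def gr_mult sum.distrib sum_distrib_left sum_distrib_right algebra_simps)
  have L_add: "L l (H + H') = L l H + L l H'" for l H H'
    by (simp add: L_def gr_add sum.distrib algebra_simps)
  have L_minus: "L l (H - H') = L l H - L l H'" for l H H'
    by (simp add: L_def gr_minus sum_subtractf algebra_simps)
  have L_0: "L l 0 = 0" for l by (simp add: L_def gr_0)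
  have L_ker: "L l H = 0" if "\<Psi> H = 0" for l H by (simp add: L_def gr_ker[OF that])

  \<comment> \<open>For \<open>l\<close> = 0 this turns out to be \<open>m\<close>; in general it is
    a proper ideal that also asks the linear form to vanish on some numerator of the
    fraction.\<close>
  define J where "J l = {Fract (\<Psi> H) (\<Psi> S) | H S. E S \<noteq> 0 \<and> E H = 0 \<and> L l H = 0}" for l
  have JI: "Fract (\<Psi> H) (\<Psi> S) \<in> J l" if "E S \<noteq> 0" "E H = 0" "L l H = 0" for l H S
    using that by (auto simp: J_def)
  have J_ideal: "ideal (J l) R" for l
    unfolding R_def localization_at_def
  proof (rule ideal_ring_of_setI)
    show "ring (ring_of_set {Fract a s |a s. a \<in> B \<and> s \<in> B \<and> s \<notin> p})"
      using R.ring_axioms by (simp add: R_def localization_at_def)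
    show "J l \<subseteq> {Fract a s |a s. a \<in> B \<and> s \<in> B \<and> s \<notin> p}"
      using carr' by (auto simp: J_def simps)
    show "0 \<in> J l" using JI[of 1 0 l] by (simp add: L_0 fract_collapse)
    fix a assume "a \<in> J l"
    then obtain H S where a: "a = Fract (\<Psi> H) (\<Psi> S)" "E S \<noteq> 0" "E H = 0" "L l H = 0"
      by (auto simp: J_def)
    show "- a \<in> J l"
      using JI[of S "- H" l] a L_minus[of l 0 H] by (simp add: E.hom_uminus \<Psi>.hom_uminus L_0)
    { fix b assume "b \<in> J l"
      then obtain H' S' where b: "b = Fract (\<Psi> H') (\<Psi> S')" "E S' \<noteq> 0" "E H' = 0" "L l H' = 0"
        by (auto simp: J_def)
      show "a + b \<in> J l"
        using JI[of "S * S'" "H * S' + H' * S" l] a b nz[OF a(2)] nz[OF b(2)]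
        by (simp add: E.hom_add E.hom_mult \<Psi>.hom_add \<Psi>.hom_mult L_add L_mult) }
    { fix r assume "r \<in> {Fract a s |a s. a \<in> B \<and> s \<in> B \<and> s \<notin> p}"
      then obtain H' S' where b: "r = Fract (\<Psi> H') (\<Psi> S')" "E S' \<noteq> 0"
        using carr[of r] by (auto simp: simps)
      show "r * a \<in> J l"
        using JI[of "S' * S" "H' * H" l] a b
        by (simp add: E.hom_mult \<Psi>.hom_mult L_mult) }
  qed
  have J_proper: "J l \<noteq> carrier R" for l
  proof
    assume "J l = carrier R"
    then have "1 \<in> J l" using R.one_closed by (simp add: simps(3))
    then obtain H S where "1 = Fract (\<Psi> H) (\<Psi> S)" "E S \<noteq> 0" "E H = 0" by (auto simp: J_def)
    then have "\<Psi> S = \<Psi> H" using nz by (auto simp: One_fract_def eq_fract)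
    then have "E S = E H" by (simp add: E_def)
    then show False using \<open>E S \<noteq> 0\<close> \<open>E H = 0\<close> by simp
  qed
  have J_eq: "J l = m" if "m \<subseteq> J l" for l
    using m.I_maximal[OF J_ideal that] J_proper ideal.axioms(1)[OF J_ideal]
    by (metis additive_subgroup.a_subset)
  have m_rep: "E H = 0" if "Fract (\<Psi> H) (\<Psi> S) \<in> m" "E S \<noteq> 0" for H S
  proof (rule ccontr)
    assume "E H \<noteq> 0"
    then have "Fract (\<Psi> S) (\<Psi> H) * Fract (\<Psi> H) (\<Psi> S) \<in> m"
      using m.I_l_closed[OF that(1) carr'[of H S]] by (simp add: simps)
    moreover have "Fract (\<Psi> S) (\<Psi> H) * Fract (\<Psi> H) (\<Psi> S) = 1"
      using nz[OF \<open>E H \<noteq> 0\<close>] nz[OF that(2)] by (simp add: One_fract_def eq_fract)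
    ultimately have "\<one>\<^bsub>R\<^esub> \<in> m" by (simp only: simps(3))
    then show False using m.one_imp_carrier m.I_notcarr by simp
  qed
  have "m \<subseteq> J (\<lambda>_. 0)"
  proof
    fix z assume z: "z \<in> m"
    then obtain H S where "z = Fract (\<Psi> H) (\<Psi> S)" "E S \<noteq> 0" using carr m.a_subset by blast
    then show "z \<in> J (\<lambda>_. 0)" using m_rep z by (auto intro!: JI simp: L_def)
  qed
  then have J0: "J (\<lambda>_. 0) = m" by (rule J_eq)
  have Gm: "G \<subseteq> m" using R.genideal_self[OF G(3)] G(4) by simp
  have "\<forall>g\<in>G. \<exists>H. \<exists>S. g = Fract (\<Psi> H) (\<Psi> S) \<and> E S \<noteq> 0 \<and> E H = 0"
    using carr G(3) Gm m_rep by (metis subsetD)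
  then obtain num where num: "\<forall>g\<in>G. \<exists>S. g = Fract (\<Psi> (num g)) (\<Psi> S) \<and> E S \<noteq> 0 \<and> E (num g) = 0"
    by (auto dest: bchoice)
  \<comment> \<open>Two generators impose at most two linear conditions on three unknowns.\<close>
  obtain l where l: "\<exists>i\<in>{..<3}. l i \<noteq> 0" "\<forall>g\<in>G. (\<Sum>i<3. l i * gr i (num g)) = 0"
    using homogeneous_system_nontrivial[of G "{..<3::nat}" "\<lambda>i g. gr i (num g)"] G(1,2) by auto
  have "G \<subseteq> J l"
  proof
    fix g assume g: "g \<in> G"
    then obtain S where "g = Fract (\<Psi> (num g)) (\<Psi> S)" "E S \<noteq> 0" "E (num g) = 0" using num by blast
    moreover have "L l (num g) = 0" using l(2) g by (simp add: L_def)
    ultimately show "g \<in> J l" using JI by metis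
  qed
  then have "m \<subseteq> J l" using R.genideal_minimal[OF J_ideal] G(4) by blast
  then have Jl: "J l = m" by (rule J_eq)
  \<comment> \<open>The fraction U/1 lies in \<open>m\<close> = \<open>J l\<close>, but possibly
    through another representative H/S. The difference \<open>U * S - H\<close> is a relation, so
    the linear form carries the vanishing over from \<open>H\<close> to \<open>U\<close>.\<close>
  have L_U: "L l U = 0" if "E U = 0" for U
  proof -
    have "Fract (\<Psi> U) (\<Psi> 1) \<in> J (\<lambda>_. 0)" using that by (intro JI) (simp_all add: L_def)
    then have "Fract (\<Psi> U) (\<Psi> 1) \<in> J l" by (simp only: J0 Jl)
    then obtain H S where HS: "Fract (\<Psi> U) (\<Psi> 1) = Fract (\<Psi> H) (\<Psi> S)" "E S \<noteq> 0" "E H = 0" "L l H = 0"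
      by (auto simp: J_def)
    then have "\<Psi> (U * S - H) = 0" using nz by (simp add: eq_fract \<Psi>.hom_minus \<Psi>.hom_mult)
    from L_ker[OF this, of l] have "L l U * E S = 0" using that HS by (simp add: L_minus L_mult)
    then show ?thesis using HS by simp
  qed
  \<comment> \<open>The three coordinates centred at the image point; their gradients are the unit
    vectors, which forces every \<open>l i\<close> to be 0.\<close>
  define U where "U i = (if i = 0 then [:varX - constK (eval_at x y (f varX)):]
     else if i = 1 then [:varY - constK (eval_at x y (f varY)):] else [:- constK (eval_at x y w), 1:])" for i :: nat
  have eK: "eval_at x y (constK r) = r" for r by (simp add: eval_at_def constK_def)
  have EU: "E (U i) = 0" for i
    by (simp add: U_def E_def \<Psi>_def Polynomial.map_poly_pCons f.hom_minus f.hom_uminus endo_constK[OF f] eK e.hom_minus e.hom_add e.hom_uminus)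
  note d0 = derivation_0[OF derivation_dX] derivation_0[OF derivation_dY]
    derivation_1[OF derivation_dX] derivation_1[OF derivation_dY]
    derivation_diff[OF derivation_dX] derivation_diff[OF derivation_dY]
    derivation_diff[OF derivation_dX, of 0, simplified] derivation_diff[OF derivation_dY, of 0, simplified]
  have grU: "gr j (U i) = (if i = j then 1 else 0)" if "i < 3" "j < 3" for i j
  proof -
    have "i = 0 \<or> i = 1 \<or> i = 2" "j = 0 \<or> j = 1 \<or> j = 2" using that by auto
    then show ?thesis
      by (elim disjE; simp add: gr_def U_def Polynomial.map_poly_pCons d0 pderiv_pCons
          ders[THEN derivation_1])
  qed
  have "l i = 0" if "i < 3" for i
  proof -
    have "L l (U i) = (\<Sum>j<3. if j = i then l j else 0)"
      unfolding L_def using that by (intro sum.cong) (auto simp: grU)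
    also have "\<dots> = l i" using that by simp
    finally show ?thesis using L_U[OF EU] by simp
  qed
  then show False using l(1) by auto
qed

subsection \<open>Keller maps with a regular extension by a linear form\<close>

lemma generator_in_range_if_regular:
  fixes f :: "'a::field_char_0 poly poly \<Rightarrow> 'a poly poly"
  assumes ac: "alg_closed TYPE('a)" and f: "is_K_alg_endo f"
    and c: "jac (f varX) (f varY) = constK c" "c \<noteq> 0"
    and reg: "regular_ring (K_subalg_gen {f varX, f varY, w})"
  shows "w \<in> range f"
proof -
  interpret f: comm_ring_hom f by (rule endo_comm_ring_hom[OF f])
  have j: "jac (f varX) (f varY) \<noteq> 0" using c by (simp add: constK_def)
  define \<Psi> where "\<Psi> = (\<lambda>H. poly (map_poly f H) w)"
  interpret \<Psi>: comm_ring_hom \<Psi> unfolding \<Psi>_def by (intro comm_ring_hom_eval endo_comm_ring_hom f)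
  have \<Psi>C: "\<Psi> [:a:] = f a" for a by (simp add: \<Psi>_def Polynomial.map_poly_pCons)
  have chain: "D (\<Psi> H) = \<Psi> (map_poly dX H) * D (f varX) + \<Psi> (map_poly dY H) * D (f varY) + \<Psi> (pderiv H) * D w"
    if "derivation D" "\<And>c. D (constK c) = 0" for D H
    unfolding \<Psi>_def by (rule chain_rule3[OF f that])
  obtain H where "H \<noteq> 0" "eval3 (f varX) (f varY) w H = 0" using algebraic_dependence by blast
  then have H: "H \<noteq> 0" "\<Psi> H = 0"
    using endo_eq_eval2[OF f] by (simp_all add: \<Psi>_def eval3_def)
  obtain F where F: "\<Psi> F = 0" "degree F \<ge> 1" "\<And>G. \<Psi> G = 0 \<Longrightarrow> F dvd G"
    using kernel_principal[OF \<Psi>.comm_ring_hom_axioms _ H] endo_inj[OF f j] \<Psi>C by auto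
  have "eval_at x y (\<Psi> (pderiv F)) \<noteq> 0" for x y
  proof
    interpret e: comm_ring_hom "eval_at x y" by (rule comm_ring_hom_eval_at)
    define E where "E = (\<lambda>H. eval_at x y (\<Psi> H))"
    interpret E: comm_ring_hom E
      by unfold_locales (simp_all add: E_def \<Psi>.hom_add \<Psi>.hom_mult e.hom_add e.hom_mult)
    assume "eval_at x y (\<Psi> (pderiv F)) = 0"
    then have Et: "E (pderiv F) = 0" by (simp add: E_def)
    define u v where "u = E (map_poly dX F)" and "v = E (map_poly dY F)"
    have e1: "u * eval_at x y (dX (f varX)) + v * eval_at x y (dX (f varY)) = 0"
      using arg_cong[OF chain[OF derivation_dX dX_simps(1), of F], of "eval_at x y"] Et F(1)
      by (simp add: derivation_0[OF derivation_dX] e.hom_add e.hom_mult u_def v_def E_def)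
    have e2: "u * eval_at x y (dY (f varX)) + v * eval_at x y (dY (f varY)) = 0"
      using arg_cong[OF chain[OF derivation_dY dY_simps(1), of F], of "eval_at x y"] Et F(1)
      by (simp add: derivation_0[OF derivation_dY] e.hom_add e.hom_mult u_def v_def E_def)
    have cj: "c = eval_at x y (dX (f varX)) * eval_at x y (dY (f varY)) -
         eval_at x y (dY (f varX)) * eval_at x y (dX (f varY))"
      using arg_cong[OF c(1), of "eval_at x y"]
      by (simp add: jac_def e.hom_minus e.hom_mult) (simp add: eval_at_def constK_def)
    let ?a = "eval_at x y (dX (f varX))" and ?b = "eval_at x y (dX (f varY))"
    let ?a' = "eval_at x y (dY (f varX))" and ?b' = "eval_at x y (dY (f varY))"
    \<comment> \<open>Cramer's rule at the point: with the t-derivative gone, the u- and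
      v-derivatives of \<open>F\<close> solve a homogeneous system of determinant
      \<open>c\<close>.\<close>
    have "u * c = (u * ?a + v * ?b) * ?b' - (u * ?a' + v * ?b') * ?b"
      by (simp add: cj algebra_simps)
    moreover have "v * c = (u * ?a' + v * ?b') * ?a - (u * ?a + v * ?b) * ?a'"
      by (simp add: cj algebra_simps)
    ultimately have "u * c = 0" "v * c = 0" by (simp_all only: e1 e2 mult_zero_left diff_self)
    then have uv: "u = 0" "v = 0" using c(2) by simp_all
    obtain G where G: "\<Psi> G = 0" "\<not> (E (map_poly dX G) = 0 \<and> E (map_poly dY G) = 0 \<and> E (pderiv G) = 0)"
      using regular_ring_gradient[OF f reg, of x y] unfolding E_def \<Psi>_def by blast
    obtain K where K: "G = F * K" using F(3)[OF G(1)] by (rule dvdE)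
    have "E F = 0" using F(1) by (simp add: E_def)
    \<comment> \<open>By the Leibniz rule the gradient of \<open>F * K\<close> at a zero of
      \<open>F\<close> is a multiple of that of \<open>F\<close>; hence all relations are singular
      there.\<close>
    then have "E (D G) = 0" if "derivation D" "E (D F) = 0" for D
      using that by (simp add: K derivation_mult E.hom_add E.hom_mult)
    then show False
      using G(2) uv Et derivation_map_poly[OF derivation_dX] derivation_map_poly[OF derivation_dY] derivation_pderiv
      unfolding u_def v_def by blast
  qed
  from zero_free_constant[OF ac this] obtain k where k: "k \<noteq> 0" "\<Psi> (pderiv F) = constK k" by blast
  \<comment> \<open>This relation has smaller degree than \<open>F\<close> yet is divisible by it,
    so it is 0. The t-derivative of \<open>F\<close> is then a constant, and \<open>F\<close> can be
    solved for t.\<close>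
  then have "\<Psi> (pderiv F - [:constK k:]) = 0" by (simp add: \<Psi>.hom_minus \<Psi>C endo_constK[OF f])
  then have dvd: "F dvd pderiv F - [:constK k:]" by (rule F(3))
  have "degree (pderiv F - [:constK k:]) < degree F"
    using F(2) by (intro degree_diff_less) (simp_all add: degree_pderiv)
  then have "pderiv F = [:constK k:]"
    using dvd_imp_degree_le[OF dvd] by fastforce
  then have "degree F - 1 = 0" by (metis degree_pderiv degree_pCons_0)
  then have "degree F = 1" using F(2) by simp
  obtain a b where ab: "F = [:a, b:]"
  proof (cases F)
    case (pCons a r)
    then have "degree r = 0" using \<open>degree F = 1\<close> by (auto split: if_splits)
    then show ?thesis using that pCons by (metis degree_eq_zeroE)
  qed
  then have b: "b = constK k" using \<open>pderiv F = [:constK k:]\<close> by (simp add: pderiv_pCons)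
  have "f a + w * constK k = 0"
    using F(1) by (simp add: \<Psi>_def ab b Polynomial.map_poly_pCons endo_constK[OF f])
  then have "- (f a * constK (inverse k)) = w * (constK k * constK (inverse k))"
    by (metis (no_types) add_eq_0_iff minus_mult_left mult.assoc)
  also have "constK k * constK (inverse k) = 1" using k(1) by (simp add: constK_def)
  finally have "w = f (- (a * constK (inverse k)))"
    by (simp add: f.hom_uminus f.hom_mult endo_constK[OF f])
  then show ?thesis by blast
qed

text \<open>A shear carries \<open>x + y\<close> to \<open>x\<close> and keeps the Jacobian.\<close>

lemma endo_surj_if_sum:
  fixes f :: "'a::field_char_0 poly poly \<Rightarrow> 'a poly poly"
  assumes ac: "alg_closed TYPE('a)" and f: "is_K_alg_endo f"
    and c: "jac (f varX) (f varY) = constK c" "c \<noteq> 0" and "varX + varY \<in> range f"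
  shows "surj f"
proof -
  define \<tau> :: "'a poly poly \<Rightarrow> 'a poly poly" where "\<tau> = eval2 (varX - varY) varY"
  define \<sigma> :: "'a poly poly \<Rightarrow> 'a poly poly" where "\<sigma> = eval2 (varX + varY) varY"
  have \<tau>: "is_K_alg_endo \<tau>" and \<sigma>: "is_K_alg_endo \<sigma>" by (simp_all add: \<tau>_def \<sigma>_def endo_eval2)
  interpret \<tau>: comm_ring_hom \<tau> by (rule endo_comm_ring_hom[OF \<tau>])
  interpret \<sigma>: comm_ring_hom \<sigma> by (rule endo_comm_ring_hom[OF \<sigma>])
  have \<tau>v: "\<tau> varX = varX - varY" "\<tau> varY = varY" by (simp_all add: \<tau>_def)
  have \<sigma>v: "\<sigma> varX = varX + varY" "\<sigma> varY = varY" by (simp_all add: \<sigma>_def)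
  have "\<sigma> \<circ> \<tau> = id"
    by (rule endo_eqI) (simp_all add: endo_comp endo_id \<tau> \<sigma> \<tau>v \<sigma>v \<sigma>.hom_minus)
  then have st: "\<sigma> (\<tau> h) = h" for h by (metis comp_apply id_apply)
  have ft: "is_K_alg_endo (\<tau> \<circ> f)" by (rule endo_comp[OF \<tau> f])
  have X: "dX (\<tau> h) = \<tau> (dX h)" for h
    using chain_rule2[OF \<tau> derivation_dX, of h]
    by (simp add: \<tau>v derivation_diff[OF derivation_dX])
  \<comment> \<open>The extra term subtracts one column of the Jacobian matrix from the other, which
    leaves the determinant alone.\<close>
  have Y: "dY (\<tau> h) = \<tau> (dY h) - \<tau> (dX h)" for h
    using chain_rule2[OF \<tau> derivation_dY, of h]
    by (simp add: \<tau>v derivation_diff[OF derivation_dY])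
  have "jac ((\<tau> \<circ> f) varX) ((\<tau> \<circ> f) varY) = \<tau> (jac (f varX) (f varY))"
    by (simp add: jac_def X Y \<tau>.hom_minus \<tau>.hom_mult algebra_simps)
  also have "\<dots> = constK c" by (simp add: c endo_constK[OF \<tau>])
  finally have j: "jac ((\<tau> \<circ> f) varX) ((\<tau> \<circ> f) varY) = constK c" .
  obtain g where "f g = varX + varY" using assms(5) by (metis rangeE)
  then have g: "(\<tau> \<circ> f) g = varX" by (simp add: \<tau>.hom_add \<tau>v)
  have "surj (\<tau> \<circ> f)" by (rule endo_surj_if_varX[OF ac ft j c(2) g])
  then have "\<exists>k. \<tau> h = \<tau> (f k)" for h by (metis comp_apply surjD)
  then have "\<exists>k. h = f k" for h using st by metis
  then show ?thesis by (simp add: surj_def)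
qed

theorem theorem4p1:
  fixes f :: "'a::field_char_0 poly poly \<Rightarrow> 'a poly poly"
  assumes "alg_closed TYPE('a)"
    and "is_K_alg_endo f"
    and "\<exists>c. c \<noteq> 0 \<and> jac (f varX) (f varY) = constK c"
    and "regular_ring (K_subalg_gen {f varX, f varY, varX + varY})"
  shows "\<exists>g. is_K_alg_endo g \<and> g \<circ> f = id \<and> f \<circ> g = id"
proof -
  note f = assms(2)
  interpret f: comm_ring_hom f by (rule endo_comm_ring_hom[OF f])
  obtain c where c: "jac (f varX) (f varY) = constK c" "c \<noteq> 0" using assms(3) by blast
  have "surj f"
    by (rule endo_surj_if_sum[OF assms(1) f c generator_in_range_if_regular[OF assms(1) f c assms(4)]])
  then have fg: "f (inv_into UNIV f h) = h" for h by (rule surj_f_inv_f)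
  have "inj f"
  proof (rule injI)
    fix a b assume "f a = f b"
    then have "f (a - b) = 0" by (simp add: f.hom_minus)
    moreover have "jac (f varX) (f varY) \<noteq> 0" using c by (simp add: constK_def)
    ultimately have "a - b = 0" using endo_inj[OF f] by blast
    then show "a = b" by simp
  qed
  then have gf: "inv_into UNIV f (f h) = h" for h by (rule inv_f_f)
  \<comment> \<open>The set-theoretic inverse of a bijective algebra endomorphism respects the
    operations and the constants.\<close>
  have "is_K_alg_endo (inv_into UNIV f)"
    unfolding is_K_alg_endo_def
    by (metis f.hom_add f.hom_mult f.hom_one endo_constK[OF f] fg gf)
  then show ?thesis using fg gf by (intro exI[of _ "inv_into UNIV f"]) auto
qed

end
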